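(* Suppose that $n=2^m-1=r_1\cdot r_2$, where $m=ab$, $r_1=2^a-1$, $\gcd(r_1,r_2)=1$ and $r_1,r_2>1$. Let $\alpha$ be a primitive $n$-th root of unity in the field with $2^m$ elements and let $T:\mathbb{Z}_n\to\mathbb{Z}_{r_1}\times\mathbb{Z}_{r_2}$ be an arbitrary isomorphism of groups. Let $\mathcal{C}^*=R^*(m-3,m)$, let $\mathcal{D}^*\subseteq\mathbb{Z}_n$ be the defining set of $\mathcal{C}^*$ with respect to $\alpha$, and let $\mathcal{C}\subseteq\mathbb{A}(r_1,r_2)$ be the abelian code with defining set $D(\mathcal{C})=T(\mathcal{D}^* )$. Then the sequences $(f_i)$ and $(g_i)$ associated with $\mathcal{C}$ are $$f_1=b^2,\quad f_2=\frac{b(b+1)}{2}\qquad\text{and}\qquad g_1=\frac{a(a-1)}{2},\quad g_2=\frac{a(a+1)}{2}.$$ Therefore, let $\Gamma=\Gamma(\mathcal{C})$, which is the set of all $(i_1,i_2)\in\mathbb{Z}_{r_1}\times\mathbb{Z}_{r_2}$ such that either $$0\le i_1<\frac{a(a-1)}{2}\ \text{ and }\ 0\le i_2<b^2,$$ or $$\frac{a(a-1)}{2}\le i_1<\frac{a(a+1)}{2}\ \text{ and }\ 0\le i_2<\frac{b(b+1)}{2}.$$ Then $T^{-1}(\Gamma)$ is a set of check positions for $R^*(m-3,m)$. Furthermore, $\{0\}\cup\{\alpha^i\mid i\in T^{-1}(\Gamma)\}$ is an information set for $R(2,m)$, and $\{\alpha^i\mid i\in\mathbb{Z}_n,\ i\notin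 T^{-1}(\Gamma)\}$ is an information set for $R(m-3,m)$.
   Context: **Reed-Muller codes.** $\mathbb{F}$ is the field with two elements, $G$ is the additive group of the field with $2^m$ elements, $G^*=G\setminus\{0\}$, $n=2^m-1$. Elements of the group algebra $\mathbb{F}G$ are written $\sum_{g\in G}a_gX^g$. For $0\le s\le n$ put $\phi_s(\sum_g a_gX^g)=\sum_g a_g g^s\in G$ (with $0^0=1$). The $2$-weight $\mathrm{wt}(k)$ of a natural number $k$ is the number of ones in its binary expansion. For $0<\rho<m$, the Reed-Muller code $R(\rho,m)\subseteq\mathbb{F}G$ is the affine-invariant code with defining set $\{i\mid 0\le i<2^m-1,\ \mathrm{wt}(i)<m-\rho\}$, i.e. $R(\rho,m)$ is the set of $x\in\mathbb{F}G$ with $\phi_i(x)=0$ for all such $i$. $R^*(\rho,m)$ is the code obtained from $R(\rho,m)$ by puncturing at the position $X^0$. For a primitive $n$-th root of unity $\alpha\in G^*$, $R^*(\rho,m)$ is identified with a cyclic code in $\mathbb{F}[X]/\langle X^n-1\rangle$, the coefficient of $X^{\alpha^i}$ corresponding to the coefficient of $X^i$, $i\in\mathbb{Z}_n$; its defining set with respect to $\alpha$ is $\{s\in\mathbb{Z}_n\mid P(\alpha^s)=0\text{ for all }P\text{ in the code}\}$, which equals $\{0<i<2^m-1\mid \mathrm{wt}(i)<m-\rho\}$. **Information sets.** For a linear code of dimension $k$ with coordinates indexed by a finite set $J$, an information set is a subset $I\subseteq J$ with $|I|=k$ such that the projection of the code onto the coordinates in $I$ is $\mathbb{F}^k$; the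 complement $J\setminus I$ is called a set of check positions. Codes in $\mathbb{F}G$ have positions indexed by $G$; $R^*(\rho,m)$, seen as a cyclic code, has positions indexed by $\mathbb{Z}_n$; codes in $\mathbb{A}(r_1,r_2)$ have positions indexed by $\mathbb{Z}_{r_1}\times\mathbb{Z}_{r_2}$. **Abelian codes.** $\mathbb{A}(r_1,r_2)=\mathbb{F}[X_1,X_2]/\langle X_1^{r_1}-1,X_2^{r_2}-1\rangle$; an abelian code is an ideal of it. For fixed primitive $r_i$-th roots of unity $\beta_i$, the defining set of $\mathcal{C}$ is $D(\mathcal{C})=\{(a_1,a_2)\in\mathbb{Z}_{r_1}\times\mathbb{Z}_{r_2}\mid P(\beta_1^{a_1},\beta_2^{a_2})=0\ \forall P\in\mathcal{C}\}$; it determines $\mathcal{C}$. Here the roots are the following: choose integers with $\eta_1r_1+\eta_2r_2=1$, put $\alpha_1=\alpha^{\eta_2r_2}$, $\alpha_2=\alpha^{\eta_1r_1}$, $T(1)=(\delta_1,\delta_2)$ and $\beta_i=\alpha_i^{\delta_i^{-1}}$ (inverse modulo $r_i$). (With this choice, $\mathcal{C}$ is the image of $\mathcal{C}^*$ under $\sum a_iX^i\mapsto\sum b_{jl}X_1^jX_2^l$, $b_{jl}=a_i$ iff $T(i)=(j,l)$.) **The sequences $(f_i)$, $(g_i)$ and the set $\Gamma(\mathcal{C})$.** The $2^\gamma$-cyclotomic coset of $a$ modulo $r$ is $C_{2^\gamma,r}(a)=\{a2^{\gamma i}\mid i\ge0\}\subseteq\mathbb{Z}_r$, and $C_r(a)=C_{2,r}(a)$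 (the case $\gamma=1$). The $2$-orbit of $(a_1,a_2)$ is $Q(a_1,a_2)=\{(a_12^i,a_22^i)\mid i\ge0\}$; $D(\mathcal{C})$ is a union of $2$-orbits. Let $\overline D\subseteq D(\mathcal{C})$ be a set of restricted representatives: it contains exactly one element of each $2$-orbit in $D(\mathcal{C})$, and its projection $\overline D_1$ to the first coordinate contains exactly one element of each $2$-cyclotomic coset modulo $r_1$ in the first projection of $D(\mathcal{C})$. Put $m(e_1)=|C_{r_1}(e_1)|$, $m(e_1,e_2)=|C_{2^{m(e_1)},r_2}(e_2)|$, and for $e_1\in\overline D_1$, $M(e_1)=\sum_{e_2:(e_1,e_2)\in\overline D}m(e_1,e_2)$. Let $f_1>\dots>f_s>0$ be the distinct values of $M$ on $\overline D_1$, $f_{s+1}=0$, and $g_i=\sum_{e_1\in\overline D_1,\,M(e_1)\ge f_i}m(e_1)$ for $1\le i\le s$. Elements of $\mathbb{Z}_{r_i}$ are identified with integers in $\{0,\dots,r_i-1\}$. Then $\Gamma(\mathcal{C})=\{(i_1,i_2)\in\mathbb{Z}_{r_1}\times\mathbb{Z}_{r_2}\mid\exists\,1\le j\le s:\ f_{j+1}\le i_2<f_j,\ 0\le i_1<g_j\}$. *)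

theory Defs
  imports
    Complex_Main
    "HOL-Algebra.Elementary_Groups"
    "HOL-Algebra.Ideal"
    "HOL-Library.Z2"
    "HOL-Library.Function_Algebras"
    "HOL-Library.Cardinality"
    "HOL-Number_Theory.Modular_Inverse"
begin

text \<open>
  The field with two elements is \<^typ>\<open>bit\<close>, embedded into other fields of characteristic 2
  by \<^term>\<open>of_bit\<close>.  The cyclic group of integers modulo \<open>r\<close> is \<^term>\<open>integer_mod_group r\<close>,
  with carrier \<open>{0..<int r}\<close> for \<open>r > 0\<close>.  Words are coefficient functions; when the set of
  positions is not a whole type, they vanish outside the set of positions.
\<close>

definition primitive_root_of_unity :: "nat \<Rightarrow> 'a::field \<Rightarrow> bool" where
  "primitive_root_of_unity n x \<longleftrightarrow> n > 0 \<and> x ^ n = 1 \<and> (\<forall>k. 0 < k \<and> k < n \<longrightarrow> x ^ k \<noteq> 1)"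


section \<open>Information sets\<close>

definition code_dim :: "('j \<Rightarrow> bit) set \<Rightarrow> nat" where
  "code_dim C = vector_space.dim (\<lambda>(c::bit) x j. c * x j) C"

definition information_set :: "'j set \<Rightarrow> ('j \<Rightarrow> bit) set \<Rightarrow> 'j set \<Rightarrow> bool" where
  "information_set J C I \<longleftrightarrow>
     I \<subseteq> J \<and> card I = code_dim C \<and> (\<lambda>x. restrict x I) ` C = (I \<rightarrow>\<^sub>E UNIV)"

definition check_positions :: "'j set \<Rightarrow> ('j \<Rightarrow> bit) set \<Rightarrow> 'j set \<Rightarrow> bool" where
  "check_positions J C S \<longleftrightarrow> S \<subseteq> J \<and> information_set J C (J - S)"


section \<open>Reed-Muller codes\<close>

definition wt :: "nat \<Rightarrow> nat" where
  "wt k = card {j. bit k j}"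

text \<open>Elements of the group algebra of the additive group of \<^typ>\<open>'a\<close> are functions
  \<open>'a \<Rightarrow> bit\<close>.  Note that \<^prop>\<open>(0::'a::field) ^ 0 = 1\<close>.\<close>

definition phi :: "nat \<Rightarrow> ('a::{field,finite} \<Rightarrow> bit) \<Rightarrow> 'a" where
  "phi s x = (\<Sum>g\<in>UNIV. of_bit (x g) * g ^ s)"

definition reed_muller :: "nat \<Rightarrow> nat \<Rightarrow> ('a::{field,finite} \<Rightarrow> bit) set" where
  "reed_muller \<rho> m = {x. \<forall>i < 2 ^ m - 1. wt i < m - \<rho> \<longrightarrow> phi i x = 0}"

text \<open>Deletes the position \<open>0\<close> and renames the remaining positions \<open>\<alpha>\<^sup>i\<close> to \<open>i\<close>, for a primitive
  \<open>n\<close>-th root of unity \<open>\<alpha>\<close> with \<open>n = CARD('a) - 1\<close>.\<close>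

definition punctured_cyclic :: "nat \<Rightarrow> 'a::{field,finite} \<Rightarrow> ('a \<Rightarrow> bit) set \<Rightarrow> (int \<Rightarrow> bit) set"
  where
  "punctured_cyclic n \<alpha> R = (\<lambda>x i. if i \<in> {0..<int n} then x (\<alpha> powi i) else 0) ` R"

definition cyclic_eval :: "nat \<Rightarrow> (int \<Rightarrow> bit) \<Rightarrow> 'a::field \<Rightarrow> 'a" where
  "cyclic_eval n P x = (\<Sum>i\<in>{0..<int n}. of_bit (P i) * x powi i)"

definition cyclic_defining_set :: "nat \<Rightarrow> 'a::field \<Rightarrow> (int \<Rightarrow> bit) set \<Rightarrow> int set" where
  "cyclic_defining_set n \<alpha> C = {s \<in> {0..<int n}. \<forall>P\<in>C. cyclic_eval n P (\<alpha> powi s) = 0}"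


section \<open>Abelian codes\<close>

definition positions :: "nat \<Rightarrow> nat \<Rightarrow> (int \<times> int) set" where
  "positions r1 r2 = {0..<int r1} \<times> {0..<int r2}"

text \<open>The algebra of polynomials in \<open>X\<^sub>1, X\<^sub>2\<close> modulo \<open>X\<^sub>1\<^bsup>r1\<^esup> - 1\<close> and \<open>X\<^sub>2\<^bsup>r2\<^esup> - 1\<close>, each residue class
  being given by the coefficients of its reduced representative.\<close>

definition abelian_algebra :: "nat \<Rightarrow> nat \<Rightarrow> (int \<times> int \<Rightarrow> bit) ring" where
  "abelian_algebra r1 r2 =
     \<lparr>carrier = {P. \<forall>k. k \<notin> positions r1 r2 \<longrightarrow> P k = 0},
      monoid.mult = (\<lambda>P Q k. if k \<in> positions r1 r2
         then \<Sum>i\<in>positions r1 r2.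
                P i * Q ((fst k - fst i) mod int r1, (snd k - snd i) mod int r2)
         else 0),
      one = (\<lambda>k. if k = (0, 0) then 1 else 0),
      zero = (\<lambda>k. 0),
      add = (\<lambda>P Q k. P k + Q k)\<rparr>"

lemma sum_positions_shift:
  fixes f :: "int \<times> int \<Rightarrow> bit"
  assumes "r1 > 0" "r2 > 0"
  shows "(\<Sum>l\<in>positions r1 r2. f ((fst l + c) mod int r1, (snd l + d) mod int r2))
       = (\<Sum>l\<in>positions r1 r2. f l)"
proof (rule sum.reindex_bij_witness
    [where j = "\<lambda>l. ((fst l + c) mod int r1, (snd l + d) mod int r2)"
       and i = "\<lambda>l. ((fst l - c) mod int r1, (snd l - d) mod int r2)"])
qed (use assms in \<open>auto simp: positions_def mod_simps\<close>)

lemma sum_positions_reflect: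
  fixes f :: "int \<times> int \<Rightarrow> bit"
  assumes "r1 > 0" "r2 > 0"
  shows "(\<Sum>l\<in>positions r1 r2. f ((c - fst l) mod int r1, (d - snd l) mod int r2))
       = (\<Sum>l\<in>positions r1 r2. f l)"
proof (rule sum.reindex_bij_witness
    [where j = "\<lambda>l. ((c - fst l) mod int r1, (d - snd l) mod int r2)"
       and i = "\<lambda>l. ((c - fst l) mod int r1, (d - snd l) mod int r2)"])
qed (use assms in \<open>auto simp: positions_def mod_simps\<close>)

lemma cring_abelian_algebra:
  assumes r: "r1 > 0" "r2 > 0"
  shows "cring (abelian_algebra r1 r2)"
proof (rule cringI)
  note add_bit_eq_xor [simp del] and mult_bit_eq_and [simp del]
  let ?A = "abelian_algebra r1 r2" and ?Z = "positions r1 r2"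
  have fin: "finite ?Z" by (simp add: positions_def)
  have pos: "((x mod int r1), (y mod int r2)) \<in> ?Z" for x y
    using r by (simp add: positions_def)
  show "abelian_group ?A"
  proof (rule abelian_groupI)
    fix P assume "P \<in> carrier ?A"
    then show "\<exists>Q\<in>carrier ?A. Q \<oplus>\<^bsub>?A\<^esub> P = \<zero>\<^bsub>?A\<^esub>"
      by (intro bexI[of _ P]) (auto simp: abelian_algebra_def fun_eq_iff add_bit_eq_xor)
  qed (auto simp: abelian_algebra_def add_ac)
  have comm: "P \<otimes>\<^bsub>?A\<^esub> Q = Q \<otimes>\<^bsub>?A\<^esub> P" for P Q
  proof
    fix k
    have "(\<Sum>i\<in>?Z. P i * Q ((fst k - fst i) mod int r1, (snd k - snd i) mod int r2))
        = (\<Sum>i\<in>?Z. Q i * P ((fst k - fst i) mod int r1, (snd k - snd i) mod int r2))"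
      if "k \<in> ?Z"
      by (subst sum_positions_reflect[OF r, symmetric, where c = "fst k" and d = "snd k"],
          rule sum.cong) (use that in \<open>auto simp: positions_def mod_simps\<close>)
    then show "(P \<otimes>\<^bsub>?A\<^esub> Q) k = (Q \<otimes>\<^bsub>?A\<^esub> P) k"
      by (simp add: abelian_algebra_def)
  qed
  show "comm_monoid ?A"
  proof (rule comm_monoidI)
    fix P Q R assume "P \<in> carrier ?A" "Q \<in> carrier ?A" "R \<in> carrier ?A"
    show "P \<otimes>\<^bsub>?A\<^esub> Q \<otimes>\<^bsub>?A\<^esub> R = P \<otimes>\<^bsub>?A\<^esub> (Q \<otimes>\<^bsub>?A\<^esub> R)"
    proof
      fix k
      let ?d = "\<lambda>k i. ((fst k - fst i) mod int r1, (snd k - snd i) mod int r2)"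
      have "(\<Sum>l\<in>?Z. (\<Sum>i\<in>?Z. P i * Q (?d l i)) * R (?d k l))
          = (\<Sum>i\<in>?Z. \<Sum>l\<in>?Z. P i * (Q (?d l i) * R (?d k l)))"
        by (subst sum.swap) (simp add: sum_distrib_right mult.assoc)
      also have "\<dots> = (\<Sum>i\<in>?Z. \<Sum>l\<in>?Z. P i * (Q l * R (?d (?d k i) l)))"
      proof (rule sum.cong[OF refl])
        fix i assume "i \<in> ?Z"
        show "(\<Sum>l\<in>?Z. P i * (Q (?d l i) * R (?d k l)))
            = (\<Sum>l\<in>?Z. P i * (Q l * R (?d (?d k i) l)))"
          by (subst sum_positions_shift[OF r, symmetric, where c = "fst i" and d = "snd i"],
              rule sum.cong)
            (auto simp: positions_def mod_simps algebra_simps)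
      qed
      also have "\<dots> = (\<Sum>i\<in>?Z. P i * (\<Sum>l\<in>?Z. Q l * R (?d (?d k i) l)))"
        by (simp add: sum_distrib_left)
      finally show "(P \<otimes>\<^bsub>?A\<^esub> Q \<otimes>\<^bsub>?A\<^esub> R) k = (P \<otimes>\<^bsub>?A\<^esub> (Q \<otimes>\<^bsub>?A\<^esub> R)) k"
        using pos by (simp add: abelian_algebra_def)
    qed
  next
    fix P assume P: "P \<in> carrier ?A"
    show "\<one>\<^bsub>?A\<^esub> \<otimes>\<^bsub>?A\<^esub> P = P"
    proof
      fix k
      have "(\<Sum>i\<in>?Z. (if i = (0, 0) then 1 else 0) *
              P ((fst k - fst i) mod int r1, (snd k - snd i) mod int r2)) =
            (\<Sum>i\<in>?Z. if i = (0, 0) then P (fst k mod int r1, snd k mod int r2) else 0)"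
        by (rule sum.cong) auto
      also have "\<dots> = P (fst k mod int r1, snd k mod int r2)"
        using r fin by (simp add: positions_def)
      finally show "(\<one>\<^bsub>?A\<^esub> \<otimes>\<^bsub>?A\<^esub> P) k = P k"
        using P by - (cases k, auto simp: abelian_algebra_def positions_def)
    qed
  qed (use r comm in \<open>auto simp: abelian_algebra_def positions_def\<close>)
  fix P Q R assume "P \<in> carrier ?A" "Q \<in> carrier ?A" "R \<in> carrier ?A"
  show "(P \<oplus>\<^bsub>?A\<^esub> Q) \<otimes>\<^bsub>?A\<^esub> R = P \<otimes>\<^bsub>?A\<^esub> R \<oplus>\<^bsub>?A\<^esub> Q \<otimes>\<^bsub>?A\<^esub> R"
    by (rule ext) (simp add: abelian_algebra_def distrib_right sum.distrib)
qed

definition abelian_eval :: "nat \<Rightarrow> nat \<Rightarrow> (int \<times> int \<Rightarrow> bit) \<Rightarrow> 'a::field \<Rightarrow> 'a \<Rightarrow> 'a" where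
  "abelian_eval r1 r2 P x y =
     (\<Sum>(i, j)\<in>positions r1 r2. of_bit (P (i, j)) * x powi i * y powi j)"

definition abelian_defining_set ::
    "nat \<Rightarrow> nat \<Rightarrow> 'a::field \<Rightarrow> 'a \<Rightarrow> (int \<times> int \<Rightarrow> bit) set \<Rightarrow> (int \<times> int) set" where
  "abelian_defining_set r1 r2 \<beta>1 \<beta>2 C =
     {(a1, a2) \<in> positions r1 r2. \<forall>P\<in>C. abelian_eval r1 r2 P (\<beta>1 powi a1) (\<beta>2 powi a2) = 0}"


section \<open>The sequences and the set of check positions of an abelian code\<close>

text \<open>The \<open>2\<^sup>\<gamma>\<close>-cyclotomic coset of \<open>a\<close> modulo \<open>r\<close>.\<close>

definition cyclotomic_coset :: "nat \<Rightarrow> nat \<Rightarrow> int \<Rightarrow> int set" where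
  "cyclotomic_coset \<gamma> r a = {(a * 2 ^ (\<gamma> * i)) mod int r | i::nat. True}"

definition two_orbit :: "nat \<Rightarrow> nat \<Rightarrow> int \<times> int \<Rightarrow> (int \<times> int) set" where
  "two_orbit r1 r2 p =
     {((fst p * 2 ^ i) mod int r1, (snd p * 2 ^ i) mod int r2) | i::nat. True}"

definition restricted_representatives ::
    "nat \<Rightarrow> nat \<Rightarrow> (int \<times> int) set \<Rightarrow> (int \<times> int) set \<Rightarrow> bool" where
  "restricted_representatives r1 r2 D Dbar \<longleftrightarrow>
     Dbar \<subseteq> D \<and>
     (\<forall>p\<in>D. \<exists>!q. q \<in> Dbar \<and> q \<in> two_orbit r1 r2 p) \<and>
     (\<forall>a\<in>fst ` D. \<exists>!e. e \<in> fst ` Dbar \<and> e \<in> cyclotomic_coset 1 r1 a)"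

definition m1 :: "nat \<Rightarrow> int \<Rightarrow> nat" where
  "m1 r1 e1 = card (cyclotomic_coset 1 r1 e1)"

definition m2 :: "nat \<Rightarrow> nat \<Rightarrow> int \<Rightarrow> int \<Rightarrow> nat" where
  "m2 r1 r2 e1 e2 = card (cyclotomic_coset (m1 r1 e1) r2 e2)"

definition M :: "nat \<Rightarrow> nat \<Rightarrow> (int \<times> int) set \<Rightarrow> int \<Rightarrow> nat" where
  "M r1 r2 Dbar e1 = (\<Sum>e2\<in>{e2. (e1, e2) \<in> Dbar}. m2 r1 r2 e1 e2)"

definition s_len :: "nat \<Rightarrow> nat \<Rightarrow> (int \<times> int) set \<Rightarrow> nat" where
  "s_len r1 r2 Dbar = card (M r1 r2 Dbar ` fst ` Dbar)"

text \<open>The values of \<^const>\<open>M\<close> in decreasing order, indexed from 1 to \<open>s\<close>, and \<open>0\<close> at \<open>s + 1\<close>.\<close>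

definition f_seq :: "nat \<Rightarrow> nat \<Rightarrow> (int \<times> int) set \<Rightarrow> nat \<Rightarrow> nat" where
  "f_seq r1 r2 Dbar i =
     (if 1 \<le> i \<and> i \<le> s_len r1 r2 Dbar
      then rev (sorted_list_of_set (M r1 r2 Dbar ` fst ` Dbar)) ! (i - 1)
      else 0)"

definition g_seq :: "nat \<Rightarrow> nat \<Rightarrow> (int \<times> int) set \<Rightarrow> nat \<Rightarrow> nat" where
  "g_seq r1 r2 Dbar i =
     (\<Sum>e1\<in>{e1 \<in> fst ` Dbar. M r1 r2 Dbar e1 \<ge> f_seq r1 r2 Dbar i}. m1 r1 e1)"

definition Gamma_set :: "nat \<Rightarrow> nat \<Rightarrow> (int \<times> int) set \<Rightarrow> (int \<times> int) set" where
  "Gamma_set r1 r2 Dbar =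
     {(i1, i2) \<in> positions r1 r2. \<exists>j. 1 \<le> j \<and> j \<le> s_len r1 r2 Dbar \<and>
        int (f_seq r1 r2 Dbar (j + 1)) \<le> i2 \<and> i2 < int (f_seq r1 r2 Dbar j) \<and>
        0 \<le> i1 \<and> i1 < int (g_seq r1 r2 Dbar j)}"

end

theory Submission
  imports Defs "HOL-Number_Theory.Residues" "HOL-Computational_Algebra.Polynomial"
begin

text \<open>
  For a set \<open>H\<close> of \<open>|E|\<close> nonzero field elements, where \<open>E\<close> is the set of exponents \<open>0 < s < n\<close> with
  \<open>wt s \<le> 2\<close>, all information-set claims reduce to the invertibility of the square matrix
  \<open>(g\<^sup>s)\<close> with \<open>g \<in> H\<close> and \<open>s \<in> E\<close>: words of \<open>R(m - 3, m)\<close> are the binary solutions of this system,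
  words of \<open>R(2, m)\<close> are by Fourier inversion the binary-valued combinations of the functions \<open>g\<^sup>s\<close>
  and a constant, and in both cases a solution with binary data is binary because squaring
  permutes the equations.

  Writing \<open>g = \<beta>\<^sub>1\<^bsup>i\<^esup> \<beta>\<^sub>2\<^bsup>j\<^esup>\<close> with \<open>(i, j) \<in> \<Gamma>\<close>, a linear relation between the rows is a polynomial in two
  variables supported on \<open>\<Gamma>\<close> that vanishes at all points \<open>(\<beta>\<^sub>1\<^bsup>s\<^esup>, \<beta>\<^sub>2\<^bsup>s\<^esup>)\<close>.  Since \<open>s\<close> runs through the
  residues \<open>2\<^bsup>i\<^esup> + 2\<^bsup>j\<^esup>\<close> with \<open>i \<le> j < m\<close>, its residues modulo \<open>2\<^bsup>a\<^esup> - 1\<close> fall into \<open>a (a - 1) / 2\<close> classes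
  with \<open>b\<^sup>2\<close> elements (\<open>i, j\<close> incongruent modulo \<open>a\<close>) and \<open>a\<close> classes with \<open>b (b + 1) / 2\<close>
  elements, which is exactly the shape of \<open>\<Gamma>\<close>; eliminating one variable after the other shows
  that the polynomial is zero.  The sequences are read off the same class sizes, because \<open>M\<close> counts
  the elements of the defining set with given first coordinate.
\<close>

section \<open>Binary weights and cyclic doubling\<close>

lemma wt_finite: "finite {j. bit (k::nat) j}"
proof (rule finite_subset)
  show "{j. bit k j} \<subseteq> {..k}"
  proof
    fix j assume "j \<in> {j. bit k j}"
    then have "k div 2 ^ j \<noteq> 0" by (auto simp: bit_iff_odd intro!: Nat.gr0I)
    then have "2 ^ j \<le> k" by (simp add: div_eq_0_iff)
    moreover have "j < 2 ^ j" by (rule less_exp)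
    ultimately have "j \<le> k" by linarith
    then show "j \<in> {..k}" by simp
  qed
qed simp

lemma wt_0 [simp]: "wt 0 = 0" by (simp add: wt_def)

lemma wt_double [simp]: "wt (2 * k) = wt k"
proof -
  have "bit (2 * k) j \<longleftrightarrow> j \<in> Suc ` {j. bit k j}" for j
    by (cases j) (auto simp: bit_Suc bit_0)
  then have "{j. bit (2 * k) j} = Suc ` {j. bit k j}" by blast
  then show ?thesis by (simp add: wt_def card_image)
qed

lemma wt_double_Suc [simp]: "wt (Suc (2 * k)) = Suc (wt k)"
proof -
  have "bit (Suc (2 * k)) j \<longleftrightarrow> j \<in> insert 0 (Suc ` {j. bit k j})" for j
    by (cases j) (auto simp: bit_Suc bit_0)
  then have "{j. bit (Suc (2 * k)) j} = insert 0 (Suc ` {j. bit k j})" by blast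
  then show ?thesis by (simp add: wt_def card_image wt_finite)
qed

text \<open>Subtraction from the all-ones number flips each of the \<open>m\<close> binary digits.
  The bound \<open>wt t \<le> m\<close> travels with the induction because the truncated subtraction
  in the even case depends on it.\<close>

lemma wt_complement: "t \<le> 2 ^ m - 1 \<Longrightarrow> wt (2 ^ m - 1 - t) = m - wt t \<and> wt t \<le> m"
proof (induction m arbitrary: t)
  case (Suc m)
  have "t div 2 \<le> 2 ^ m - 1" using Suc.prems by auto
  note IH = Suc.IH[OF this]
  show ?case
  proof (cases "even t")
    case True
    then obtain u where u: "t = 2 * u" by blast
    have "2 ^ Suc m - 1 - t = Suc (2 * (2 ^ m - 1 - u))"
      using Suc.prems u zero_less_power[of "2::nat" m] unfolding power_Suc by linarith
    then show ?thesis using IH u by (simp add: Suc_diff_le)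
  next
    case False
    then obtain u where u: "t = Suc (2 * u)" by (auto elim: oddE)
    have "2 ^ Suc m - 1 - t = 2 * (2 ^ m - 1 - u)" using Suc.prems u by auto
    then show ?thesis using IH u by simp
  qed
qed simp

lemma wt_exp_add: "s < 2 ^ k \<Longrightarrow> wt (2 ^ k + s) = Suc (wt s)"
proof (induction k arbitrary: s)
  case 0 then show ?case using wt_double_Suc[of 0] by simp
next
  case (Suc k)
  have "s div 2 < 2 ^ k" using Suc.prems by auto
  note IH = Suc.IH[OF this]
  show ?case
  proof (cases "even s")
    case True
    then obtain u where u: "s = 2 * u" by blast
    then have "2 ^ Suc k + s = 2 * (2 ^ k + u)" by simp
    then show ?thesis using IH u by (simp only: wt_double) simp
  next
    case False
    then obtain u where u: "s = Suc (2 * u)" by (auto elim: oddE)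
    then have "2 ^ Suc k + s = Suc (2 * (2 ^ k + u))" by simp
    then show ?thesis using IH u by (simp only: wt_double_Suc) simp
  qed
qed

text \<open>Doubling modulo \<open>2 ^ m - 1\<close> rotates the \<open>m\<close> binary digits: a
  top digit 0 gives a plain shift, a top digit 1 reappears as the lowest digit.\<close>

lemma double_mod:
  fixes m s :: nat
  assumes "s < 2 ^ m - 1"
  shows "s < 2 ^ (m - 1) \<and> (2 * s) mod (2 ^ m - 1) = 2 * s
       \<or> (\<exists>u < 2 ^ (m - 1). s = 2 ^ (m - 1) + u \<and> (2 * s) mod (2 ^ m - 1) = Suc (2 * u))"
proof (cases m)
  case (Suc k)
  show ?thesis
  proof (cases "s < 2 ^ k")
    case True
    have "2 * s < 2 ^ m - 1" if "s \<noteq> 2 ^ k - 1"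
      using True that Suc by (simp; linarith)
    moreover have "2 * s < 2 ^ m - 1" if "s = 2 ^ k - 1"
      using True that Suc by (simp add: algebra_simps; linarith)
    ultimately show ?thesis using True Suc by (metis diff_Suc_1 mod_less)
  next
    case False
    then obtain u where u: "s = 2 ^ k + u" by (metis le_Suc_ex not_less)
    have "2 * s = (2 ^ m - 1) + Suc (2 * u)" using u Suc by simp
    moreover have "Suc (2 * u) < 2 ^ m - 1" using assms u Suc by simp
    ultimately have "(2 * s) mod (2 ^ m - 1) = Suc (2 * u)"
      by (metis mod_add_self1 mod_less)
    moreover have "u < 2 ^ k" using assms u Suc by simp
    ultimately show ?thesis using u Suc by auto
  qed
qed (use assms in simp)

lemma wt_double_mod:
  fixes m s :: nat
  assumes "s < 2 ^ m - 1"
  shows "wt ((2 * s) mod (2 ^ m - 1)) = wt s"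
  using double_mod[OF assms] by (auto simp: wt_exp_add)

lemma wt_double_pow_mod:
  fixes m s :: nat
  assumes "s < 2 ^ m - 1"
  shows "wt ((2 ^ j * s) mod (2 ^ m - 1)) = wt s"
proof (induction j)
  case (Suc j)
  have "(2 ^ Suc j * s) mod (2 ^ m - 1) = (2 * ((2 ^ j * s) mod (2 ^ m - 1))) mod (2 ^ m - 1)"
    by (simp add: mod_mult_right_eq mult.assoc)
  then show ?case using Suc wt_double_mod[of "(2 ^ j * s) mod (2 ^ m - 1)" m] assms by simp
qed (use assms in simp)

text \<open>The exponent set \<open>E\<close> with a general weight bound in place of 2. Exponent 0
  is kept apart: \<open>phi 0 x = 0\<close> is the only equation that involves the position
  0.\<close>

definition low_weight :: "nat \<Rightarrow> nat \<Rightarrow> nat set" where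
  "low_weight m \<rho> = {s. 0 < s \<and> s < 2 ^ m - 1 \<and> wt s \<le> \<rho>}"

lemma finite_low_weight [simp]: "finite (low_weight m \<rho>)"
  by (rule finite_subset[of _ "{..2 ^ m}"]) (auto simp: low_weight_def)

text \<open>The parity of the doubled residue is the digit that was carried around, so it reveals
  which branch of \<open>double_mod\<close> applies, and each branch is injective.\<close>

lemma inj_on_double_mod:
  "inj_on (\<lambda>s. (2 * s) mod (2 ^ m - 1)) {..<2 ^ m - 1 :: nat}"
proof (rule inj_onI)
  let ?d = "\<lambda>s. (2 * s) mod (2 ^ m - 1 :: nat)"
  fix s t :: nat
  assume s: "s \<in> {..<2 ^ m - 1}" and t: "t \<in> {..<2 ^ m - 1}" and eq: "?d s = ?d t"
  have even: "?d x = 2 * x" if "x \<in> {..<2 ^ m - 1}" "even (?d x)" for x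
    using double_mod[of x m] that by auto
  have odd: "\<exists>u. x = 2 ^ (m - 1) + u \<and> ?d x = Suc (2 * u)" if "x \<in> {..<2 ^ m - 1}" "odd (?d x)" for x
    using double_mod[of x m] that by auto
  show "s = t"
  proof (cases "even (?d s)")
    case True
    then have "2 * s = 2 * t" using even[OF s] even[OF t] eq by metis
    then show ?thesis by simp
  next
    case False
    then obtain u v where "s = 2 ^ (m - 1) + u" "t = 2 ^ (m - 1) + v" "Suc (2 * u) = Suc (2 * v)"
      using odd[OF s] odd[OF t] eq by metis
    then show ?thesis by simp
  qed
qed

lemma double_mod_in_low_weight:
  assumes "s \<in> low_weight m \<rho>"
  shows "(2 * s) mod (2 ^ m - 1) \<in> low_weight m \<rho>"
proof -
  have "(2 * s) mod (2 ^ m - 1) < 2 ^ m - 1" using assms by (auto simp: low_weight_def)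
  moreover have "(2 * s) mod (2 ^ m - 1) \<noteq> 0"
    using double_mod[of s m] assms by (auto simp: low_weight_def)
  ultimately show ?thesis using assms wt_double_mod[of s m] by (simp add: low_weight_def)
qed

lemma bij_betw_double_mod:
  "bij_betw (\<lambda>s. (2 * s) mod (2 ^ m - 1)) (low_weight m \<rho>) (low_weight m \<rho>)"
proof -
  have "inj_on (\<lambda>s. (2 * s) mod (2 ^ m - 1)) (low_weight m \<rho>)"
    by (rule inj_on_subset[OF inj_on_double_mod]) (auto simp: low_weight_def)
  then show ?thesis
    unfolding bij_betw_def using double_mod_in_low_weight
    by (metis (no_types, lifting) endo_inj_surj finite_low_weight image_subsetI)
qed

section \<open>Square systems, information sets and interpolation\<close>

text \<open>Over a finite field counting replaces dimension: a linear map that is injective between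
  finite sets of equal size is onto.\<close>

lemma square_system_solvable:
  fixes E :: "'i \<Rightarrow> 'j \<Rightarrow> 'a::{field,finite}"
  assumes fin: "finite I" "finite J" and card: "card I = card J"
    and inj: "\<And>w. (\<forall>j\<in>J. (\<Sum>i\<in>I. w i * E i j) = 0) \<Longrightarrow> \<forall>i\<in>I. w i = 0"
  shows "\<exists>w. \<forall>j\<in>J. (\<Sum>i\<in>I. w i * E i j) = v j"
proof -
  define F where "F = (\<lambda>w. restrict (\<lambda>j. \<Sum>i\<in>I. w i * E i j) J)"
  have "inj_on F (I \<rightarrow>\<^sub>E UNIV)"
  proof (rule inj_onI)
    fix w w' assume w: "w \<in> I \<rightarrow>\<^sub>E UNIV" "w' \<in> I \<rightarrow>\<^sub>E UNIV" "F w = F w'"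
    have "(\<Sum>i\<in>I. w i * E i j) = (\<Sum>i\<in>I. w' i * E i j)" if "j \<in> J" for j
      using fun_cong[OF w(3), of j] that by (simp add: F_def)
    then have "\<forall>j\<in>J. (\<Sum>i\<in>I. (w i - w' i) * E i j) = 0"
      by (simp add: left_diff_distrib sum_subtractf)
    from inj[OF this] show "w = w'" using w(1,2) by (auto intro: PiE_ext)
  qed
  then have "card (F ` (I \<rightarrow>\<^sub>E UNIV)) = card (J \<rightarrow>\<^sub>E (UNIV :: 'a set))"
    using fin card by (simp add: card_image card_PiE)
  moreover have "F ` (I \<rightarrow>\<^sub>E UNIV) \<subseteq> (J \<rightarrow>\<^sub>E UNIV)" by (auto simp: F_def)
  ultimately have "F ` (I \<rightarrow>\<^sub>E UNIV) = (J \<rightarrow>\<^sub>E UNIV)"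
    using fin by (intro card_subset_eq) (auto intro: finite_PiE)
  moreover have "restrict v J \<in> J \<rightarrow>\<^sub>E UNIV" by auto
  ultimately obtain w where "restrict v J = F w" by blast
  then have w: "restrict v J j = F w j" for j by simp
  have "(\<Sum>i\<in>I. w i * E i j) = v j" if "j \<in> J" for j
    using w[of j] that by (simp add: F_def)
  then show ?thesis by blast
qed

text \<open>Row and column kernels vanish together: pairing the relation \<open>c\<close> with a
  solution for the \<open>k\<close>-th unit vector isolates \<open>c k\<close>.\<close>

lemma transposed_system_injective:
  fixes E :: "'i \<Rightarrow> 'j \<Rightarrow> 'a::{field,finite}"
  assumes fin: "finite I" "finite J" and card: "card I = card J"
    and inj: "\<And>w. (\<forall>j\<in>J. (\<Sum>i\<in>I. w i * E i j) = 0) \<Longrightarrow> \<forall>i\<in>I. w i = 0"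
    and c: "\<forall>i\<in>I. (\<Sum>j\<in>J. c j * E i j) = 0"
  shows "\<forall>j\<in>J. c j = 0"
proof
  fix k assume k: "k \<in> J"
  obtain w where w: "\<forall>j\<in>J. (\<Sum>i\<in>I. w i * E i j) = (if j = k then 1 else 0)"
    using square_system_solvable[where E = E and v = "\<lambda>j. if j = k then 1 else 0", OF fin card inj]
    by metis
  have "0 = (\<Sum>i\<in>I. w i * (\<Sum>j\<in>J. c j * E i j))" using c by simp
  also have "\<dots> = (\<Sum>i\<in>I. \<Sum>j\<in>J. c j * (w i * E i j))"
    by (simp add: sum_distrib_left algebra_simps)
  also have "\<dots> = (\<Sum>j\<in>J. c j * (\<Sum>i\<in>I. w i * E i j))"
    by (subst sum.swap) (simp add: sum_distrib_left)
  also have "\<dots> = (\<Sum>j\<in>J. if j = k then c j else 0)"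
    using w by (intro sum.cong) auto
  also have "\<dots> = c k" using k fin by simp
  finally show "c k = 0" by simp
qed

text \<open>A projection with trivial kernel that reaches every word on \<open>I\<close> is an
  isomorphism, so \<open>card I\<close> is the dimension. Closure under scalars follows from
  \<open>zero\<close> because the scalars are bits.\<close>

lemma information_setI:
  fixes C :: "('j \<Rightarrow> bit) set"
  assumes I: "I \<subseteq> J" "finite I"
    and zero: "(\<lambda>_. 0) \<in> C" and add: "\<And>x y. x \<in> C \<Longrightarrow> y \<in> C \<Longrightarrow> (\<lambda>j. x j + y j) \<in> C"
    and inj: "\<And>x. x \<in> C \<Longrightarrow> \<forall>i\<in>I. x i = 0 \<Longrightarrow> x = (\<lambda>_. 0)"
    and surj: "\<And>y. \<exists>x\<in>C. \<forall>i\<in>I. x i = y i"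
  shows "information_set J C I"
proof -
  note add_bit_eq_xor [simp del] and mult_bit_eq_and [simp del]
  define scale where "scale = (\<lambda>(c::bit) (x::'j \<Rightarrow> bit) j. c * x j)"
  interpret V: vector_space scale
    by unfold_locales (simp_all add: scale_def fun_eq_iff distrib_left distrib_right mult.assoc)
  have sub: "V.subspace C"
  proof (rule V.subspaceI)
    show "0 \<in> C" using zero by (simp add: zero_fun_def)
    show "x + y \<in> C" if "x \<in> C" "y \<in> C" for x y using add[OF that] by (simp add: plus_fun_def)
    show "scale c x \<in> C" if "x \<in> C" for c x
      using that zero by (cases c) (auto simp: scale_def)
  qed
  \<comment> \<open>Code words dual to the coordinates in \<open>I\<close>; they turn out to be a
    basis of \<open>C\<close>.\<close>
  define z where "z = (\<lambda>i. SOME x. x \<in> C \<and> (\<forall>k\<in>I. x k = (if k = i then 1 else 0)))"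
  have "\<exists>x. x \<in> C \<and> (\<forall>k\<in>I. x k = (if k = i then 1 else 0))" for i
    using surj[of "\<lambda>k. if k = i then 1 else 0"] unfolding Bex_def .
  from someI_ex[OF this] have z: "z i \<in> C \<and> (\<forall>k\<in>I. z i k = (if k = i then 1 else 0))" for i
    unfolding z_def .
  then have zC: "z i \<in> C" and zI: "k \<in> I \<Longrightarrow> z i k = (if k = i then 1 else 0)" for i k
    by (metis, metis)
  have sum_apply: "(\<Sum>i\<in>A. f i) k = (\<Sum>i\<in>A. f i k)" for A and f :: "'b \<Rightarrow> 'j \<Rightarrow> bit" and k
    by (induction A rule: infinite_finite_induct) auto
  have injz: "inj_on z I"
  proof (rule inj_onI)
    fix i i' assume *: "i \<in> I" "i' \<in> I" "z i = z i'"
    have "z i i = 1" "z i' i = (if i = i' then 1 else 0)" using zI[OF *(1), of i] zI[OF *(1), of i'] by simp_all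
    then show "i = i'" using *(3) by (simp split: if_splits)
  qed
  have coord: "(\<Sum>i\<in>I. scale (f i) (z i)) k = f k" if "k \<in> I" for f k
  proof -
    have "(\<Sum>i\<in>I. scale (f i) (z i)) k = (\<Sum>i\<in>I. if i = k then f i else 0)"
      by (subst sum_apply, rule sum.cong) (simp_all add: scale_def zI[OF that])
    then show ?thesis using I that by simp
  qed
  have indep: "V.independent (z ` I)"
  proof (rule V.independent_if_scalars_zero)
    fix f x assume f: "(\<Sum>x\<in>z ` I. scale (f x) x) = 0" and "x \<in> z ` I"
    then obtain i where i: "i \<in> I" "x = z i" by blast
    have "(\<Sum>i\<in>I. scale (f (z i)) (z i)) = 0" using f injz by (simp add: sum.reindex)
    then show "f x = 0" using coord[OF i(1), of "\<lambda>i. f (z i)"] i by simp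
  qed (use I in simp)
  have span: "C \<subseteq> V.span (z ` I)"
  proof
    fix x assume x: "x \<in> C"
    \<comment> \<open>The combination of basis words that agrees with \<open>x\<close> on
      \<open>I\<close>. In characteristic 2 the word \<open>x + y\<close> lies in the kernel of the
      projection, hence \<open>x = y\<close>.\<close>
    define y where "y = (\<Sum>i\<in>I. scale (x i) (z i))"
    have "y \<in> C" unfolding y_def by (intro V.subspace_sum[OF sub] V.subspace_scale[OF sub] zC)
    then have "(\<lambda>j. x j + y j) = (\<lambda>_. 0)"
      using x by (intro inj add) (auto simp: y_def coord simp flip: mult_2)
    then have "x = y" by (simp add: fun_eq_iff add_eq_0_iff)
    moreover have "y \<in> V.span (z ` I)" unfolding y_def
      by (intro V.span_sum V.span_scale V.span_base imageI)
    ultimately show "x \<in> V.span (z ` I)" by simp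
  qed
  have "V.dim C = card (z ` I)"
    by (rule V.basis_card_eq_dim[OF _ span indep, symmetric]) (use zC in blast)
  then have "code_dim C = card I"
    using injz by (simp add: code_dim_def scale_def card_image)
  moreover have "(\<lambda>x. restrict x I) ` C = (I \<rightarrow>\<^sub>E UNIV)"
  proof
    show "(I \<rightarrow>\<^sub>E UNIV) \<subseteq> (\<lambda>x. restrict x I) ` C"
    proof
      fix y :: "'j \<Rightarrow> bit" assume y: "y \<in> I \<rightarrow>\<^sub>E UNIV"
      obtain x where "x \<in> C" "\<forall>i\<in>I. x i = y i" using surj by blast
      then show "y \<in> (\<lambda>x. restrict x I) ` C"
        using y by (intro image_eqI[of _ _ x]) (auto simp: fun_eq_iff PiE_def extensional_def)
    qed
  qed auto
  ultimately show ?thesis using I by (simp add: information_set_def)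
qed

text \<open>The values \<open>c j\<close> are the coefficients of a polynomial of degree below
  \<open>d\<close> with at least \<open>d\<close> roots.\<close>

lemma vandermonde_injective:
  fixes c :: "nat \<Rightarrow> 'a::field"
  assumes "finite V" "d \<le> card V" "\<forall>v\<in>V. (\<Sum>j<d. c j * v ^ j) = 0" "j < d"
  shows "c j = 0"
proof (rule ccontr)
  assume "c j \<noteq> 0"
  define p where "p = (\<Sum>j<d. monom (c j) j)"
  have "coeff p j = c j" using assms(4) by (simp add: p_def coeff_sum)
  with \<open>c j \<noteq> 0\<close> have "p \<noteq> 0" by auto
  have "degree p < d" using assms(4)
    by (auto simp: p_def intro!: degree_sum_less order.strict_trans1[OF degree_monom_le])
  moreover have "V \<subseteq> {x. poly p x = 0}" using assms(3) by (auto simp: p_def poly_sum poly_monom)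
  then have "card V \<le> card {x. poly p x = 0}" using \<open>p \<noteq> 0\<close> by (intro card_mono poly_roots_finite)
  ultimately show False using card_poly_roots_bound[OF \<open>p \<noteq> 0\<close>] assms(2) by simp
qed

text \<open>Substituting a first coordinate from \<open>A\<close> leaves a polynomial in the second variable with more
  roots than its degree allows, so the coefficient polynomials in the first variable vanish on \<open>A\<close>;
  those belonging to the rows \<open>j \<ge> f2\<close> have degree less than \<open>card A\<close> and are therefore zero.  What is
  left has degree less than \<open>f2\<close> in the second variable, and the same step applies to \<open>B\<close>.\<close>

lemma two_step_interpolation:
  fixes P :: "nat \<Rightarrow> nat \<Rightarrow> 'a::field" and D :: "('a \<times> 'a) set"
  assumes fin: "finite D" "finite A" "finite B" and disj: "A \<inter> B = {}"
    and A: "\<And>u. u \<in> A \<Longrightarrow> f1 \<le> card {v. (u, v) \<in> D}"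
    and B: "\<And>u. u \<in> B \<Longrightarrow> f2 \<le> card {v. (u, v) \<in> D}"
    and f: "f2 \<le> f1" and g: "g1 = card A" "g2 = card A + card B"
    and zero: "\<And>u v. (u, v) \<in> D \<Longrightarrow>
      (\<Sum>i<g1. \<Sum>j<f1. P i j * u ^ i * v ^ j) + (\<Sum>i=g1..<g2. \<Sum>j<f2. P i j * u ^ i * v ^ j) = 0"
  shows "(i < g1 \<longrightarrow> j < f1 \<longrightarrow> P i j = 0) \<and> (i < g2 \<longrightarrow> j < f2 \<longrightarrow> P i j = 0)"
proof -
  \<comment> \<open>Extension by zero from the staircase to the full rectangle of sides
    \<open>g2\<close> and \<open>f1\<close>, so that the two summations can be exchanged.\<close>
  define Q where "Q = (\<lambda>i j. if i < g1 \<or> j < f2 then P i j else 0)"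
  have D: "finite {v. (u, v) \<in> D}" for u
    by (rule finite_subset[of _ "snd ` D"]) (use fin in force)+
  have Qzero: "(\<Sum>j<f1. (\<Sum>i<g2. Q i j * u ^ i) * v ^ j) = 0" if "(u, v) \<in> D" for u v
  proof -
    have "(\<Sum>j<f1. (\<Sum>i<g2. Q i j * u ^ i) * v ^ j) = (\<Sum>i<g2. \<Sum>j<f1. Q i j * u ^ i * v ^ j)"
      by (subst sum.swap) (simp add: sum_distrib_right)
    also have "\<dots> = (\<Sum>i<g1. \<Sum>j<f1. Q i j * u ^ i * v ^ j) + (\<Sum>i=g1..<g2. \<Sum>j<f1. Q i j * u ^ i * v ^ j)"
      using g by (subst sum.union_disjoint[symmetric]) (auto intro!: sum.cong)
    also have "(\<Sum>i=g1..<g2. \<Sum>j<f1. Q i j * u ^ i * v ^ j) = (\<Sum>i=g1..<g2. \<Sum>j<f2. P i j * u ^ i * v ^ j)"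
      by (intro sum.cong[OF refl] sum.mono_neutral_cong_right) (use f in \<open>auto simp: Q_def\<close>)
    also have "(\<Sum>i<g1. \<Sum>j<f1. Q i j * u ^ i * v ^ j) = (\<Sum>i<g1. \<Sum>j<f1. P i j * u ^ i * v ^ j)"
      by (intro sum.cong refl) (auto simp: Q_def)
    finally show ?thesis using zero[OF that] by simp
  qed
  have A0: "(\<Sum>i<g2. Q i j * u ^ i) = 0" if "u \<in> A" "j < f1" for u j
    by (rule vandermonde_injective[OF D A[OF that(1)] _ that(2)]) (use Qzero in auto)
  have high: "Q i j = 0" if j: "f2 \<le> j" "j < f1" and "i < g1" for i j
  proof (rule vandermonde_injective[OF fin(2) _ _ that(3)])
    have "(\<Sum>i<g1. Q i j * u ^ i) = (\<Sum>i<g2. Q i j * u ^ i)" for u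
      by (rule sum.mono_neutral_left) (use g j in \<open>auto simp: Q_def\<close>)
    then show "\<forall>u\<in>A. (\<Sum>i<g1. Q i j * u ^ i) = 0" using A0 j by simp
  qed (use g in simp)
  have high': "Q i j = 0" if "f2 \<le> j" "j < f1" for i j
    using high[OF that, of i] that by (cases "i < g1") (auto simp: Q_def)
  have B0: "(\<Sum>i<g2. Q i j * u ^ i) = 0" if "u \<in> B" "j < f2" for u j
  proof (rule vandermonde_injective[OF D B[OF that(1)] _ that(2)])
    have "(\<Sum>j<f2. (\<Sum>i<g2. Q i j * u ^ i) * v ^ j) = (\<Sum>j<f1. (\<Sum>i<g2. Q i j * u ^ i) * v ^ j)" for v
      by (rule sum.mono_neutral_left) (use f high' in auto)
    then show "\<forall>v\<in>{v. (u, v) \<in> D}. (\<Sum>j<f2. (\<Sum>i<g2. Q i j * u ^ i) * v ^ j) = 0"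
      using Qzero by simp
  qed
  have low: "Q i j = 0" if "j < f2" "i < g2" for i j
    by (rule vandermonde_injective[where V = "A \<union> B", OF _ _ _ that(2)])
      (use fin disj g A0 B0 that(1) f in \<open>auto simp: card_Un_disjoint\<close>)
  show ?thesis
    using high[of j i] low[of j i] g by (cases "f2 \<le> j") (auto simp: Q_def)
qed

section \<open>Reed-Muller codes as solution spaces\<close>

lemma primitive_power_eq_iff:
  fixes x :: "'a::field"
  assumes "primitive_root_of_unity r x"
  shows "x ^ s = x ^ t \<longleftrightarrow> s mod r = t mod r"
proof -
  have r: "0 < r" "x ^ r = 1" "\<And>k. 0 < k \<Longrightarrow> k < r \<Longrightarrow> x ^ k \<noteq> 1"
    using assms by (auto simp: primitive_root_of_unity_def)
  have "x \<noteq> 0" using r(1,2) by (auto simp: power_0_left)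
  have mod: "x ^ k = x ^ (k mod r)" for k
    by (metis r(2) div_mult_mod_eq mult.commute mult_1 power_add power_mult power_one)
  have "inj_on (\<lambda>k. x ^ k) {..<r}"
  proof (rule linorder_inj_onI)
    fix i j assume "i < j" "i \<in> {..<r}" "j \<in> {..<r}"
    then have "x ^ (j - i) \<noteq> 1" using r(3)[of "j - i"] by simp
    moreover have "x ^ j = x ^ (j - i) * x ^ i" using \<open>i < j\<close> by (simp flip: power_add)
    ultimately show "x ^ i \<noteq> x ^ j" using \<open>x \<noteq> 0\<close> by simp
  qed auto
  then show ?thesis using mod[of s] mod[of t] r(1)
    by (metis inj_on_def lessThan_iff mod_less_divisor)
qed

lemma primitive_powi_eq_iff:
  fixes x :: "'a::field"
  assumes "primitive_root_of_unity r x"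
  shows "x powi i = x powi j \<longleftrightarrow> i mod int r = j mod int r"
proof -
  have r: "0 < r" "x ^ r = 1" using assms by (auto simp: primitive_root_of_unity_def)
  then have "x \<noteq> 0" by (auto simp: power_0_left)
  have mod: "x powi k = x ^ nat (k mod int r)" for k
  proof -
    have period: "x powi (int r * q + t) = x powi t" for q t
      using \<open>x \<noteq> 0\<close> r(2) by (simp add: power_int_add power_int_mult)
    have "x powi k = x powi (int r * (k div int r) + k mod int r)" by simp
    also have "\<dots> = x powi (k mod int r)" by (rule period)
    also have "\<dots> = x ^ nat (k mod int r)" using r(1) by (simp add: power_int_def)
    finally show ?thesis .
  qed
  have "nat (k mod int r) mod r = nat (k mod int r)" for k using r(1) by (simp add: nat_less_iff)
  then show ?thesis unfolding mod primitive_power_eq_iff[OF assms]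
    using r(1) by (simp add: eq_nat_nat_iff)
qed

section \<open>Characteristic two, power sums and Fourier inversion in the field with
  \<open>2 ^ m\<close> elements\<close>

locale char2_field =
  fixes m n :: nat and \<alpha> :: "'a::{field,finite}"
  assumes card_field: "CARD('a) = 2 ^ m" and n_eq: "n = 2 ^ m - 1"
    and prim: "primitive_root_of_unity n \<alpha>"
begin

lemma exp_eq_Suc_n: "2 ^ m = Suc n"
  by (simp add: n_eq)

lemma low_weight_n: "low_weight m \<rho> = {s. 0 < s \<and> s < n \<and> wt s \<le> \<rho>}"
  by (simp add: low_weight_def n_eq)

lemma reed_muller_n: "reed_muller \<rho> m = {x :: 'a \<Rightarrow> bit. \<forall>i<n. wt i < m - \<rho> \<longrightarrow> phi i x = 0}"
  by (simp add: reed_muller_def n_eq)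

lemma wt_n_minus: "t \<le> n \<Longrightarrow> wt (n - t) = m - wt t" and wt_le_m: "t \<le> n \<Longrightarrow> wt t \<le> m"
  using wt_complement[of t m] by (simp_all add: n_eq)

lemma n_pos: "n > 0" and alpha_pow_n: "\<alpha> ^ n = 1"
  using prim by (auto simp: primitive_root_of_unity_def)

lemma alpha_nz [simp]: "\<alpha> \<noteq> 0"
  using alpha_pow_n n_pos by (auto simp: power_0_left)

lemma alpha_pow_eq_1_iff: "\<alpha> ^ k = 1 \<longleftrightarrow> n dvd k"
  using primitive_power_eq_iff[OF prim, of k 0] by (simp add: dvd_eq_mod_eq_0)

lemma alpha_inj: "inj_on (\<lambda>i. \<alpha> ^ i) {..<n}"
  by (rule inj_onI) (simp add: primitive_power_eq_iff[OF prim])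

lemma alpha_image: "(\<lambda>i. \<alpha> ^ i) ` {..<n} = UNIV - {0}"
  by (rule card_subset_eq) (auto simp: card_image[OF alpha_inj] card_Diff_subset card_field exp_eq_Suc_n)

lemma alpha_bij: "bij_betw (\<lambda>i. \<alpha> ^ i) {..<n} (UNIV - {0})"
  using alpha_inj alpha_image by (simp add: bij_betw_def)

lemma pow_n: "g \<noteq> 0 \<Longrightarrow> g ^ n = 1" for g :: 'a
proof -
  assume "g \<noteq> 0"
  then obtain i where "g = \<alpha> ^ i" using alpha_image by blast
  then show ?thesis by (metis alpha_pow_n mult.commute power_mult power_one)
qed

lemma pow_mod: "g ^ k = g ^ (k mod n)" if "g \<noteq> 0" for g :: 'a
  by (metis pow_n[OF that] div_mult_mod_eq mult.commute mult_1 power_add power_mult power_one)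

lemma pow_card: "g ^ (2 ^ m) = g" for g :: 'a
proof (cases "g = 0")
  case False
  then show ?thesis using pow_n[OF False] by (simp add: exp_eq_Suc_n)
qed (simp add: power_0_left)

text \<open>Translation by 1 permutes the field, so the sum of all elements does not change when 1
  is added to each of them. This yields characteristic 2.\<close>

lemma of_nat_card: "of_nat (2 ^ m) = (0::'a)"
proof -
  have "(\<Sum>g\<in>UNIV. g) = (\<Sum>g\<in>UNIV. g + (1::'a))"
    by (rule sum.reindex_bij_witness[of _ "\<lambda>g. g + 1" "\<lambda>g. g - 1"]) auto
  also have "\<dots> = (\<Sum>g\<in>UNIV. g) + of_nat CARD('a)"
    by (simp add: sum.distrib)
  finally show ?thesis using card_field by simp
qed

lemma two_zero: "(2::'a) = 0"
  using of_nat_card by simp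

lemma add_self [simp]: "x + x = 0" for x :: 'a
  using two_zero by (metis mult_2 mult_zero_left)

lemma minus_eq [simp]: "- x = x" for x :: 'a
  by (metis add_self minus_unique)

lemma diff_eq [simp]: "x - y = x + y" for x y :: 'a
  by (metis diff_conv_add_uminus minus_eq)

lemma of_nat_n: "of_nat n = (1::'a)"
  using of_nat_card exp_eq_Suc_n by (metis add_self add_right_cancel of_nat_Suc)

lemma square_add: "(x + y) ^ 2 = x ^ 2 + y ^ 2" for x y :: 'a
  by (simp add: power2_sum two_zero)

lemma square_sum: "(\<Sum>i\<in>A. f i) ^ 2 = (\<Sum>i\<in>A. f i ^ 2)" for f :: "'b \<Rightarrow> 'a"
  by (induction A rule: infinite_finite_induct) (auto simp: square_add)

lemma square_eq_self: "x ^ 2 = x \<longleftrightarrow> x = 0 \<or> x = 1" for x :: 'a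
  by (auto simp: power2_eq_square)

text \<open>Substituting \<open>\<alpha> * g\<close> for \<open>g\<close> multiplies the sum by
  \<open>\<alpha> ^ j\<close>, so it vanishes unless \<open>n\<close> divides \<open>j\<close>. For
  \<open>j = 0\<close> the convention \<open>0 ^ 0 = 1\<close> adds one more term and the sum
  becomes \<open>2 ^ m = 0\<close>.\<close>

lemma sum_powers: "(\<Sum>g\<in>UNIV. g ^ j) = (if 0 < j \<and> n dvd j then 1 else (0::'a))"
proof -
  have split: "(\<Sum>g\<in>UNIV. g ^ j) = 0 ^ j + (\<Sum>g\<in>UNIV - {0}. g ^ j :: 'a)"
    by (rule sum.remove) auto
  consider "j = 0" | "0 < j" "n dvd j" | "\<not> n dvd j" by auto
  then show ?thesis
  proof cases
    case 1 then show ?thesis using of_nat_card card_field by simp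
  next
    case 2
    have "g ^ j = 1" if "g \<noteq> 0" for g :: 'a
      using pow_mod[OF that, of j] 2 by simp
    then have "(\<Sum>g\<in>UNIV - {0::'a}. g ^ j) = (\<Sum>g\<in>UNIV - {0::'a}. 1)" by (intro sum.cong) auto
    also have "\<dots> = of_nat n" by (simp add: card_Diff_subset card_field exp_eq_Suc_n)
    finally show ?thesis using 2 split of_nat_n by (simp add: power_0_left)
  next
    case 3
    then have *: "\<alpha> ^ j \<noteq> 1" by (simp add: alpha_pow_eq_1_iff)
    have "(\<Sum>g\<in>UNIV. g ^ j) = (\<Sum>g\<in>UNIV. (\<alpha> * g) ^ j)"
      by (rule sum.reindex_bij_witness[of _ "\<lambda>g. \<alpha> * g" "\<lambda>g. g / \<alpha>"]) auto
    also have "\<dots> = \<alpha> ^ j * (\<Sum>g\<in>UNIV. g ^ j)"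
      by (simp add: power_mult_distrib sum_distrib_left)
    finally have "(\<alpha> ^ j - 1) * (\<Sum>g\<in>UNIV. g ^ j) = 0"
      by (simp only: left_diff_distrib) simp
    then show ?thesis using * 3 by (simp del: diff_eq)
  qed
qed

lemma of_bit_add: "(of_bit (x + y) :: 'a) = of_bit x + of_bit y"
  by (cases x; cases y) auto

lemma of_bit_sum: "(of_bit (\<Sum>i\<in>A. f i) :: 'a) = (\<Sum>i\<in>A. of_bit (f i))"
proof (induction A rule: infinite_finite_induct)
  case (insert x F)
  have "of_bit (\<Sum>i\<in>insert x F. f i) = (of_bit (f x + (\<Sum>i\<in>F. f i)) :: 'a)"
    by (simp only: sum.insert[OF insert(1,2)])
  then show ?case by (simp only: of_bit_add sum.insert[OF insert(1,2)] insert(3))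
qed simp_all

lemma of_bit_inj: "(of_bit x :: 'a) = of_bit y \<longleftrightarrow> x = y"
  by (cases x; cases y) auto

lemma of_bit_eq_0: "(of_bit x :: 'a) = 0 \<longleftrightarrow> x = 0"
  by (cases x) auto

lemma ex_of_bit: "x ^ 2 = x \<Longrightarrow> \<exists>b. x = (of_bit b :: 'a)"
  unfolding square_eq_self by (metis of_bool_eq even_zero odd_one)

text \<open>The return from field-valued functions to words: only 0 and 1 are fixed by
  squaring.\<close>

lemma ex_bit_word:
  "(\<And>g. h g ^ 2 = h g) \<Longrightarrow> \<exists>x. \<forall>g. of_bit (x g) = (h g :: 'a)"
  by (rule choice) (metis ex_of_bit)

lemma phi_add: "phi s (\<lambda>g. x g + y g) = phi s x + (phi s y :: 'a)"
  unfolding phi_def of_bit_add by (simp add: distrib_right sum.distrib)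

lemma phi_zero: "phi s (\<lambda>_. 0) = (0::'a)"
  by (simp add: phi_def)

lemma reed_muller_zero: "(\<lambda>_::'a. 0) \<in> reed_muller \<rho> m"
  by (simp add: reed_muller_n phi_zero)

lemma reed_muller_add:
  "x \<in> reed_muller \<rho> m \<Longrightarrow> y \<in> reed_muller \<rho> m \<Longrightarrow> (\<lambda>g::'a. x g + y g) \<in> reed_muller \<rho> m"
  by (simp add: reed_muller_def phi_add del: add_bit_eq_xor)

text \<open>The order \<open>m - 1 - \<rho>\<close> turns the strict weight bound of the definition
  into \<open>wt s \<le> \<rho>\<close>. The overall parity check, exponent 0, is split off.\<close>

lemma dual_reed_muller_iff:
  fixes x :: "'a \<Rightarrow> bit"
  assumes "\<rho> < m"
  shows "x \<in> reed_muller (m - 1 - \<rho>) m \<longleftrightarrow> phi 0 x = 0 \<and> (\<forall>s\<in>low_weight m \<rho>. phi s x = 0)"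
proof -
  have "m - (m - 1 - \<rho>) = Suc \<rho>" using assms by simp
  then show ?thesis unfolding reed_muller_n low_weight_n using n_pos
    by (auto simp: less_Suc_eq_le) (metis gr0I)
qed

text \<open>The kernel of Fourier inversion. For distinct nonzero \<open>g\<close> and
  \<open>h\<close> it is a geometric series in \<open>g / h\<close> over a full period. For
  \<open>h = 0\<close> only \<open>t = n\<close> contributes, through \<open>0 ^ 0 = 1\<close>; this
  is where the constant term of the expansion comes from.\<close>

lemma geometric_kernel:
  fixes g h :: 'a
  shows "(\<Sum>t=1..n. h ^ (n - t) * g ^ t) = (if g \<noteq> 0 \<and> (h = 0 \<or> h = g) then 1 else 0)"
proof -
  consider "g = 0" | "g \<noteq> 0" "h = 0" | "g \<noteq> 0" "h = g" | "g \<noteq> 0" "h \<noteq> 0" "h \<noteq> g" by blast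
  then show ?thesis
  proof cases
    case 1 then show ?thesis by (auto intro!: sum.neutral)
  next
    case 2
    have "(\<Sum>t=1..n. h ^ (n - t) * g ^ t) = (\<Sum>t\<in>{n}. h ^ (n - t) * g ^ t)"
      by (rule sum.mono_neutral_right) (use 2 n_pos in \<open>auto simp: power_0_left\<close>)
    then show ?thesis using 2 pow_n[of g] by simp
  next
    case 3
    have "h ^ (n - t) * g ^ t = 1" if "t \<in> {1..n}" for t
      using that 3 pow_n[of g] by (simp flip: power_add)
    then have "(\<Sum>t=1..n. h ^ (n - t) * g ^ t) = (\<Sum>t=1..n. 1)" by (intro sum.cong) auto
    then show ?thesis using 3 of_nat_n by simp
  next
    case 4
    define q where "q = g / h"
    have q: "q ^ n = 1" "q \<noteq> 1" using 4 by (auto simp: q_def intro: pow_n)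
    have "h ^ (n - t) * g ^ t = q ^ t" if "t \<in> {1..n}" for t
    proof -
      have "h ^ (n - t) * h ^ t = 1" using that 4 pow_n[of h] by (simp flip: power_add)
      moreover have "g ^ t = q ^ t * h ^ t" using 4 by (simp add: q_def power_divide)
      ultimately show ?thesis by (simp add: mult.assoc mult.left_commute)
    qed
    then have "(\<Sum>t=1..n. h ^ (n - t) * g ^ t) = (\<Sum>t=1..n. q ^ t)" by (intro sum.cong) auto
    also have "\<dots> = q * (\<Sum>t<n. q ^ t)"
      using n_pos by (simp add: sum_distrib_left sum.atLeast1_atMost_eq)
    also have "(\<Sum>t<n. q ^ t) = 0"
      using q by (simp add: sum_gp_strict del: diff_eq)
    finally show ?thesis using 4 by simp
  qed
qed

text \<open>After inserting \<open>phi\<close> and exchanging the sums, the kernel selects the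
  positions 0 and \<open>g\<close>; the value at 0 then cancels against the constant term.\<close>

lemma fourier_expansion:
  fixes x :: "'a \<Rightarrow> bit"
  shows "of_bit (x g) = of_bit (x 0) + (\<Sum>t=1..n. phi (n - t) x * g ^ t)"
proof -
  have "(\<Sum>t=1..n. phi (n - t) x * g ^ t) = (\<Sum>h\<in>UNIV. of_bit (x h) * (\<Sum>t=1..n. h ^ (n - t) * g ^ t))"
    unfolding phi_def sum_distrib_right sum_distrib_left
    by (subst sum.swap) (simp only: mult.assoc)
  also have "\<dots> = (\<Sum>h\<in>UNIV. if g \<noteq> 0 \<and> (h = 0 \<or> h = g) then of_bit (x h) else 0)"
    by (rule sum.cong[OF refl]) (simp only: geometric_kernel, simp)
  also have "\<dots> = (\<Sum>h\<in>(if g = 0 then {} else {0, g}). of_bit (x h))"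
    by (rule sum.mono_neutral_cong_right) (auto split: if_splits)
  also have "\<dots> = of_bit (x 0) + of_bit (x g)"
    by simp
  finally show ?thesis by (simp flip: add.assoc)
qed

text \<open>Since \<open>n - t\<close> has weight \<open>m - wt t\<close>, the defining equations
  remove every coefficient with \<open>wt t > \<rho>\<close>. The term \<open>t = n\<close> falls to
  the equation for exponent 0.\<close>

lemma reed_muller_expansion:
  fixes x :: "'a \<Rightarrow> bit"
  assumes "x \<in> reed_muller \<rho> m" "\<rho> < m"
  shows "of_bit (x g) = of_bit (x 0) + (\<Sum>t\<in>low_weight m \<rho>. phi (n - t) x * g ^ t)"
proof -
  have "phi (n - t) x = 0" if "t \<in> {1..n} - low_weight m \<rho>" for t
  proof -
    have "wt (n - t) < m - \<rho>"
    proof (cases "t = n")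
      case False
      then have "\<rho> < wt t" using that by (auto simp: low_weight_n)
      then show ?thesis using wt_n_minus[of t] wt_le_m[of t] that by auto
    qed (use assms in simp)
    then show ?thesis using assms(1) that n_pos by (simp add: reed_muller_n)
  qed
  moreover have "low_weight m \<rho> \<subseteq> {1..n}" by (auto simp: low_weight_n)
  ultimately have "(\<Sum>t=1..n. phi (n - t) x * g ^ t) = (\<Sum>t\<in>low_weight m \<rho>. phi (n - t) x * g ^ t)"
    by (intro sum.mono_neutral_right ballI) simp_all
  then show ?thesis using fourier_expansion[of x g] by simp
qed

text \<open>By the power sums, \<open>g ^ t\<close> contributes to \<open>phi i x\<close> only if
  \<open>n\<close> divides \<open>t + i\<close>. The ranges force \<open>i = n - t\<close>, whose
  weight is at least \<open>m - \<rho>\<close>, outside the defining set.\<close>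

lemma reed_mullerI_expansion:
  fixes x :: "'a \<Rightarrow> bit"
  assumes "\<And>g. of_bit (x g) = c0 + (\<Sum>t\<in>low_weight m \<rho>. c t * g ^ t)" "\<rho> < m"
  shows "x \<in> reed_muller \<rho> m"
  unfolding reed_muller_n
proof (intro CollectI allI impI)
  fix i assume i: "i < n" "wt i < m - \<rho>"
  have "phi i x = (\<Sum>g\<in>UNIV. c0 * g ^ i) + (\<Sum>t\<in>low_weight m \<rho>. \<Sum>g\<in>UNIV. c t * g ^ (t + i))"
    unfolding phi_def assms(1)
    by (subst sum.swap) (simp add: distrib_right sum.distrib sum_distrib_right power_add mult.assoc)
  also have "(\<Sum>g\<in>UNIV. c0 * g ^ i) = 0"
    using i(1) by (auto simp: sum_powers nat_dvd_not_less simp flip: sum_distrib_left)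
  also have "(\<Sum>t\<in>low_weight m \<rho>. \<Sum>g\<in>UNIV. c t * g ^ (t + i)) = 0"
  proof (rule sum.neutral, rule ballI)
    fix t assume t: "t \<in> low_weight m \<rho>"
    have "\<not> n dvd t + i"
    proof
      assume "n dvd t + i"
      moreover have "0 < t + i" "t + i < 2 * n" using t i by (auto simp: low_weight_n)
      ultimately obtain k where "t + i = n * k" "0 < k" "k < 2"
        by (metis dvdE gr0I less_not_refl mult.commute mult_0 mult_less_cancel2)
      then have "t + i = n" by (simp add: numeral_2_eq_2 less_Suc_eq)
      then have "i = n - t" by simp
      then have "wt i = m - wt t" using wt_n_minus[of t] t by (simp add: low_weight_n)
      moreover have "wt t \<le> \<rho>" using t by (simp add: low_weight_n)
      ultimately show False using i(2) by arith
    qed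
    then show "(\<Sum>g\<in>UNIV. c t * g ^ (t + i)) = 0"
      by (simp add: sum_powers flip: sum_distrib_left)
  qed
  finally show "phi i x = 0" by simp
qed


text \<open>The equations for \<open>s\<close> squared are the equations for \<open>2 s\<close> in the squared unknowns, and
  \<open>s \<mapsto> 2 s\<close> permutes \<^term>\<open>low_weight m \<rho>\<close>.  Together with uniqueness of solutions over \<^typ>\<open>'a\<close> this
  forces solutions with binary data to be binary.\<close>

lemma low_weight_square:
  fixes F :: "'a set"
  assumes "\<And>s. s \<in> low_weight m \<rho> \<Longrightarrow> (\<Sum>g\<in>F. w g * g ^ s) = 0" and s: "s \<in> low_weight m \<rho>"
  shows "(\<Sum>g\<in>F. w g ^ 2 * g ^ s) = (0::'a)"
proof -
  obtain t where t: "t \<in> low_weight m \<rho>" "s = (2 * t) mod n"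
    using bij_betw_double_mod[of m \<rho>] s unfolding bij_betw_def n_eq by blast
  have "(\<Sum>g\<in>F. w g ^ 2 * g ^ s) = (\<Sum>g\<in>F. (w g * g ^ t) ^ 2)"
  proof (rule sum.cong[OF refl])
    fix g show "w g ^ 2 * g ^ s = (w g * g ^ t) ^ 2"
    proof (cases "g = 0")
      case True
      have "0 < s" "0 < t" using s t(1) by (auto simp: low_weight_n)
      then show ?thesis using True by (simp add: power_0_left)
    next
      case False
      then show ?thesis using pow_mod[OF False, of "2 * t"] t(2)
        by (simp add: power_mult_distrib mult.commute flip: power_mult)
    qed
  qed
  also have "\<dots> = 0" unfolding square_sum[symmetric] assms(1)[OF t(1)] by simp
  finally show ?thesis .
qed

section \<open>Information sets from an invertible matrix of powers\<close>

context
  fixes H :: "'a set" and \<rho> :: nat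
  assumes H: "0 \<notin> H" and cardH: "card H = card (low_weight m \<rho>)" and \<rho>: "\<rho> < m"
    and H_inj: "\<And>w. (\<forall>s\<in>low_weight m \<rho>. (\<Sum>g\<in>H. w g * g ^ s) = 0) \<Longrightarrow> \<forall>g\<in>H. w g = (0::'a)"
begin

lemma transposed_inj:
  assumes "\<forall>g\<in>H. (\<Sum>s\<in>low_weight m \<rho>. c s * g ^ s) = 0"
  shows "\<forall>s\<in>low_weight m \<rho>. c s = (0::'a)"
  by (rule transposed_system_injective[OF finite finite_low_weight cardH, where E = "\<lambda>g s. g ^ s"])
    (use H_inj assms in auto)

text \<open>By the expansion a word is given by its value at 0 and its coefficients, and the values
  on \<open>H\<close> determine the coefficients through the transposed system. For surjectivity the
  interpolating function must be shown to be binary everywhere, not only on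
  \<open>H\<close>.\<close>

lemma reed_muller_information_set: "information_set UNIV (reed_muller \<rho> m) (insert 0 H)"
proof (rule information_setI)
  fix x :: "'a \<Rightarrow> bit" assume x: "x \<in> reed_muller \<rho> m" "\<forall>g\<in>insert 0 H. x g = 0"
  note exp = reed_muller_expansion[OF x(1) \<rho>]
  have "\<forall>g\<in>H. (\<Sum>s\<in>low_weight m \<rho>. phi (n - s) x * g ^ s) = 0"
  proof
    fix g assume "g \<in> H"
    then show "(\<Sum>s\<in>low_weight m \<rho>. phi (n - s) x * g ^ s) = 0" using exp[of g] x(2) by simp
  qed
  from transposed_inj[OF this] have "of_bit (x g) = (0::'a)" for g
    using exp[of g] x(2) by simp
  then show "x = (\<lambda>_. 0)" by (auto simp: of_bit_eq_0 fun_eq_iff)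
next
  fix y :: "'a \<Rightarrow> bit"
  \<comment> \<open>The constant term is fixed by the value at the position 0, so the other terms
    have to supply \<open>y g + y 0\<close> on \<open>H\<close>.\<close>
  have "\<exists>c. \<forall>g\<in>H. (\<Sum>s\<in>low_weight m \<rho>. c s * g ^ s) = of_bit (y g) + (of_bit (y 0) :: 'a)"
    by (rule square_system_solvable[OF finite_low_weight finite cardH[symmetric], where E = "\<lambda>s g. g ^ s"])
      (rule transposed_inj)
  then obtain c where c: "\<And>g. g \<in> H \<Longrightarrow>
      (\<Sum>s\<in>low_weight m \<rho>. c s * g ^ s) = of_bit (y g) + (of_bit (y 0) :: 'a)"
    by blast
  define h where "h = (\<lambda>g. of_bit (y 0) + (\<Sum>s\<in>low_weight m \<rho>. c s * g ^ s))"
  \<comment> \<open>The coefficients of the square of \<open>h\<close>: those of \<open>h\<close>,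
    squared and moved along the doubling permutation.\<close>
  define c' where "c' = (\<lambda>s. c (inv_into (low_weight m \<rho>) (\<lambda>s. (2 * s) mod n) s) ^ 2)"
  have h2: "h g ^ 2 = of_bit (y 0) + (\<Sum>s\<in>low_weight m \<rho>. c' s * g ^ s)" for g
  proof -
    have inj: "inj_on (\<lambda>s. (2 * s) mod n) (low_weight m \<rho>)"
      using bij_betw_double_mod[of m \<rho>] by (simp add: bij_betw_def n_eq)
    have "(\<Sum>s\<in>low_weight m \<rho>. c s * g ^ s) ^ 2 = (\<Sum>s\<in>low_weight m \<rho>. c' ((2 * s) mod n) * g ^ ((2 * s) mod n))"
      unfolding square_sum
    proof (rule sum.cong[OF refl])
      fix s assume s: "s \<in> low_weight m \<rho>"
      have "(g ^ s) ^ 2 = g ^ ((2 * s) mod n)"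
      proof (cases "g = 0")
        case True
        have "0 < s" "0 < (2 * s) mod n"
          using s double_mod_in_low_weight[OF s] by (auto simp: low_weight_n n_eq)
        then show ?thesis using True by (simp add: power_0_left)
      next
        case False
        then show ?thesis using pow_mod[OF False, of "2 * s"]
          by (simp add: mult.commute flip: power_mult)
      qed
      then show "(c s * g ^ s) ^ 2 = c' ((2 * s) mod n) * g ^ ((2 * s) mod n)"
        using s by (simp add: c'_def inv_into_f_f[OF inj] power_mult_distrib)
    qed
    also have "\<dots> = (\<Sum>s\<in>low_weight m \<rho>. c' s * g ^ s)"
      by (rule sum.reindex_bij_betw) (use bij_betw_double_mod[of m \<rho>] in \<open>simp add: n_eq\<close>)
    finally show ?thesis by (simp add: h_def square_add)
  qed
  have hH: "h g = of_bit (y g)" if "g \<in> H" for g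
    using c[OF that] by (simp add: h_def two_zero flip: add.assoc)
  \<comment> \<open>On \<open>H\<close> the function \<open>h\<close> is binary and equals its
    square; uniqueness of the coefficients spreads this equality to the whole field.\<close>
  have "\<forall>g\<in>H. (\<Sum>s\<in>low_weight m \<rho>. (c' s + c s) * g ^ s) = 0"
  proof
    fix g assume "g \<in> H"
    then have "h g ^ 2 + h g = 0" by (simp add: hH)
    then have "of_bit (y 0) + (\<Sum>s\<in>low_weight m \<rho>. c' s * g ^ s)
        + (of_bit (y 0) + (\<Sum>s\<in>low_weight m \<rho>. c s * g ^ s)) = 0" unfolding h2 unfolding h_def .
    then show "(\<Sum>s\<in>low_weight m \<rho>. (c' s + c s) * g ^ s) = 0"
      by (simp add: distrib_right sum.distrib add.left_commute two_zero)
  qed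
  from transposed_inj[OF this] have "c' s = c s" if "s \<in> low_weight m \<rho>" for s
    using that by (metis add_eq_0_iff minus_eq)
  then have "h g ^ 2 = h g" for g unfolding h2 unfolding h_def by simp
  then obtain x where x: "\<And>g. of_bit (x g) = h g" using ex_bit_word[of h] by blast
  have "x \<in> reed_muller \<rho> m"
    by (rule reed_mullerI_expansion[OF _ \<rho>]) (simp only: x h_def)
  moreover have "x g = y g" if "g \<in> insert 0 H" for g
  proof -
    have "h 0 = of_bit (y 0)" by (auto simp: h_def low_weight_n intro!: sum.neutral)
    then have "(of_bit (x g) :: 'a) = of_bit (y g)" using that hH x by auto
    then show ?thesis by (simp only: of_bit_inj)
  qed
  ultimately show "\<exists>x\<in>reed_muller \<rho> m. \<forall>g\<in>insert 0 H. x g = y g" by blast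
qed (auto intro: reed_muller_zero reed_muller_add simp del: add_bit_eq_xor)

text \<open>The equations with \<open>s > 0\<close> do not see the position 0, so they first force
  \<open>x\<close> to vanish on \<open>H\<close>; the parity check then removes the value at
  0.\<close>

lemma dual_reed_muller_inj:
  assumes "x \<in> reed_muller (m - 1 - \<rho>) m" "\<forall>g\<in>- insert 0 H. x g = 0"
  shows "x = (\<lambda>_. 0)"
proof -
  have phi: "phi 0 x = 0" "\<And>s. s \<in> low_weight m \<rho> \<Longrightarrow> phi s x = 0"
    using assms(1) dual_reed_muller_iff[OF \<rho>] by auto
  have "\<forall>s\<in>low_weight m \<rho>. (\<Sum>g\<in>H. of_bit (x g) * g ^ s) = 0"
  proof
    fix s assume s: "s \<in> low_weight m \<rho>"
    have "(\<Sum>g\<in>H. of_bit (x g) * g ^ s) = phi s x" unfolding phi_def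
      by (rule sum.mono_neutral_left) (use assms(2) s in \<open>auto simp: low_weight_n\<close>)
    then show "(\<Sum>g\<in>H. of_bit (x g) * g ^ s) = 0" using phi(2)[OF s] by simp
  qed
  from H_inj[OF this] have xH: "x g = 0" if "g \<in> H" for g
    using that of_bit_eq_0 by blast
  have nz: "x g = 0" if "g \<noteq> 0" for g using xH[of g] assms(2) that by auto
  have "phi 0 x = of_bit (x 0) * 0 ^ 0 + (\<Sum>g\<in>UNIV - {0}. of_bit (x g) * g ^ 0)"
    unfolding phi_def by (rule sum.remove) auto
  also have "(\<Sum>g\<in>UNIV - {0}. of_bit (x g) * g ^ 0) = (0::'a)"
    by (rule sum.neutral) (use nz in auto)
  finally have "x 0 = 0" using phi(1) by (simp split: if_splits)
  then show ?thesis using nz by (metis ext)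
qed

text \<open>The prescribed values on \<open>F\<close> form the right-hand side of the system for the
  values on \<open>H\<close>. Its solution is binary by the squaring argument, and the position 0
  remains free for the parity check.\<close>

lemma dual_reed_muller_surj:
  fixes y :: "'a \<Rightarrow> bit"
  obtains x where "x \<in> reed_muller (m - 1 - \<rho>) m" "\<forall>g\<in>- insert 0 H. x g = y g"
proof -
  define F where "F = - insert 0 H"
  have "\<exists>w. \<forall>s\<in>low_weight m \<rho>. (\<Sum>g\<in>H. w g * g ^ s) = (\<Sum>g\<in>F. of_bit (y g) * g ^ s)"
    by (rule square_system_solvable[OF finite finite_low_weight cardH, where E = "\<lambda>g s. g ^ s"])
      (rule H_inj)
  then obtain w where w: "\<And>s. s \<in> low_weight m \<rho> \<Longrightarrow>
      (\<Sum>g\<in>H. w g * g ^ s) = (\<Sum>g\<in>F. of_bit (y g) * g ^ s)" by blast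
  define u where "u = (\<lambda>g. if g \<in> H then w g else if g = 0 then 0 else of_bit (y g))"
  have split: "(\<Sum>g\<in>UNIV - {0}. v g) = (\<Sum>g\<in>H. v g) + (\<Sum>g\<in>F. v g)" for v :: "'a \<Rightarrow> 'b::comm_monoid_add"
    by (subst sum.union_disjoint[symmetric]) (use H in \<open>auto simp: F_def intro!: sum.cong\<close>)
  have u0: "(\<Sum>g\<in>UNIV - {0}. u g * g ^ s) = 0" if "s \<in> low_weight m \<rho>" for s
  proof -
    have "(\<Sum>g\<in>UNIV - {0}. u g * g ^ s) = (\<Sum>g\<in>H. w g * g ^ s) + (\<Sum>g\<in>F. of_bit (y g) * g ^ s)"
      unfolding split by (intro arg_cong2[where f = "(+)"] sum.cong) (auto simp: u_def F_def)
    then show ?thesis using w[OF that] by simp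
  qed
  have u2: "(\<Sum>g\<in>UNIV - {0}. u g ^ 2 * g ^ s) = 0" if "s \<in> low_weight m \<rho>" for s
    by (rule low_weight_square[where w = u, OF u0 that])
  \<comment> \<open>Both \<open>u\<close> and its square solve the equations and they agree off
    \<open>H\<close>, so their sum is a relation supported on \<open>H\<close>.\<close>
  have "\<forall>s\<in>low_weight m \<rho>. (\<Sum>g\<in>H. (u g ^ 2 + u g) * g ^ s) = 0"
  proof
    fix s assume s: "s \<in> low_weight m \<rho>"
    have "(\<Sum>g\<in>F. (u g ^ 2 + u g) * g ^ s) = 0"
      by (rule sum.neutral) (auto simp: u_def F_def)
    then have "(\<Sum>g\<in>H. (u g ^ 2 + u g) * g ^ s) = (\<Sum>g\<in>UNIV - {0}. (u g ^ 2 + u g) * g ^ s)"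
      unfolding split by simp
    then show "(\<Sum>g\<in>H. (u g ^ 2 + u g) * g ^ s) = 0"
      using u0[OF s] u2[OF s] by (simp add: distrib_right sum.distrib)
  qed
  from H_inj[OF this] have "u g ^ 2 = u g" if "g \<in> H" for g
    using that by (metis add_eq_0_iff minus_eq)
  then have "u g ^ 2 = u g" for g by (cases "g \<in> H") (auto simp: u_def)
  then obtain z where z: "\<And>g. of_bit (z g) = u g" using ex_bit_word[of u] by blast
  \<comment> \<open>The value at 0 is the parity of all other values, which makes
    \<open>phi 0 x\<close> vanish.\<close>
  define x where "x = z(0 := \<Sum>g\<in>UNIV - {0}. z g)"
  have "phi s x = 0" if s: "s \<in> low_weight m \<rho>" for s
  proof -
    have "phi s x = (\<Sum>g\<in>UNIV - {0}. of_bit (x g) * g ^ s)" unfolding phi_def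
      by (rule sum.mono_neutral_right) (use s in \<open>auto simp: low_weight_n\<close>)
    also have "\<dots> = (\<Sum>g\<in>UNIV - {0}. u g * g ^ s)"
      by (rule sum.cong) (auto simp: x_def simp flip: z)
    finally show ?thesis using u0[OF s] by simp
  qed
  moreover have "phi 0 x = 0"
  proof -
    have "phi 0 x = of_bit (\<Sum>g\<in>UNIV. x g)" unfolding of_bit_sum by (simp add: phi_def)
    also have "(\<Sum>g\<in>UNIV. x g) = x 0 + (\<Sum>g\<in>UNIV - {0}. x g)" by (rule sum.remove) auto
    also have "(\<Sum>g\<in>UNIV - {0}. x g) = x 0"
      unfolding x_def fun_upd_same by (rule sum.cong) auto
    finally show ?thesis by (cases "x 0") auto
  qed
  ultimately have "x \<in> reed_muller (m - 1 - \<rho>) m" using dual_reed_muller_iff[OF \<rho>] by blast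
  moreover have "x g = y g" if "g \<in> - insert 0 H" for g
  proof -
    have "(of_bit (x g) :: 'a) = of_bit (y g)" using that z[of g] by (auto simp: x_def u_def)
    then show ?thesis by (simp only: of_bit_inj)
  qed
  ultimately show ?thesis using that by blast
qed

lemma dual_reed_muller_information_set:
  "information_set UNIV (reed_muller (m - 1 - \<rho>) m) (- insert 0 H)"
proof (rule information_setI)
  show "\<exists>x\<in>reed_muller (m - 1 - \<rho>) m. \<forall>g\<in>- insert 0 H. x g = y g" for y
    using dual_reed_muller_surj[of y] by blast
qed (auto intro: reed_muller_zero reed_muller_add intro!: dual_reed_muller_inj simp del: add_bit_eq_xor)

text \<open>The deleted position 0 lies outside the information set of the unpunctured code, so
  injectivity and surjectivity survive puncturing and are only renamed along
  \<open>i \<mapsto> \<alpha> powi i\<close>.\<close>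

lemma punctured_check_positions:
  assumes S: "S \<subseteq> {0..<int n}" "(\<lambda>i. \<alpha> powi i) ` S = H"
  shows "check_positions {0..<int n} (punctured_cyclic n \<alpha> (reed_muller (m - 1 - \<rho>) m)) S"
proof -
  let ?R = "reed_muller (m - 1 - \<rho>) m :: ('a \<Rightarrow> bit) set"
  let ?p = "\<lambda>(x :: 'a \<Rightarrow> bit) i. if i \<in> {0..<int n} then x (\<alpha> powi i) else 0"
  have powi_inj: "inj_on (\<lambda>i. \<alpha> powi i) {0..<int n}"
    by (rule inj_onI) (simp add: primitive_powi_eq_iff[OF prim])
  have off: "\<exists>i\<in>{0..<int n} - S. g = \<alpha> powi i" if "g \<in> - insert 0 H" for g
  proof -
    have "g \<in> (\<lambda>i. \<alpha> ^ i) ` {..<n}" unfolding alpha_image using that by simp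
    then obtain k where k: "k < n" "g = \<alpha> powi int k" by auto
    have "int k \<notin> S"
    proof
      assume "int k \<in> S"
      then have "g \<in> H" unfolding k(2) by (simp only: S(2)[symmetric] imageI)
      then show False using that by simp
    qed
    then show ?thesis using k by (intro bexI[of _ "int k"]) auto
  qed
  have in_off: "\<alpha> powi i \<in> - insert 0 H" if "i \<in> {0..<int n} - S" for i
  proof
    assume "\<alpha> powi i \<in> insert 0 H"
    then obtain j where j: "j \<in> S" "\<alpha> powi i = \<alpha> powi j" using that unfolding S(2)[symmetric] by auto
    then have "i = j" using inj_onD[OF powi_inj j(2)] that S(1) by blast
    then show False using j(1) that by blast
  qed
  have "information_set {0..<int n} (?p ` ?R) ({0..<int n} - S)"
  proof (rule information_setI)
    show "(\<lambda>_. 0) \<in> ?p ` ?R" by (rule image_eqI[OF _ reed_muller_zero]) auto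
  next
    fix P Q assume "P \<in> ?p ` ?R" "Q \<in> ?p ` ?R"
    then obtain x y where xy: "x \<in> ?R" "P = ?p x" "y \<in> ?R" "Q = ?p y" by blast
    then have "(\<lambda>i. P i + Q i) = ?p (\<lambda>g. x g + y g)" by (auto simp del: add_bit_eq_xor)
    then show "(\<lambda>i. P i + Q i) \<in> ?p ` ?R"
      using reed_muller_add[OF xy(1,3)] by (rule image_eqI)
  next
    fix P assume "P \<in> ?p ` ?R" "\<forall>i\<in>{0..<int n} - S. P i = 0"
    then obtain x where x: "x \<in> ?R" "P = ?p x" by blast
    have "\<forall>g\<in>- insert 0 H. x g = 0"
      using off \<open>\<forall>i\<in>_ - S. P i = 0\<close> x(2) by fastforce
    from dual_reed_muller_inj[OF x(1) this] show "P = (\<lambda>_. 0)" using x(2) by auto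
  next
    fix y :: "int \<Rightarrow> bit"
    obtain x where x: "x \<in> ?R"
      "\<forall>g\<in>- insert 0 H. x g = y (inv_into {0..<int n} (\<lambda>i. \<alpha> powi i) g)"
      by (rule dual_reed_muller_surj)
    have "\<forall>i\<in>{0..<int n} - S. ?p x i = y i"
      using x(2) in_off inv_into_f_f[OF powi_inj] by auto
    then show "\<exists>P\<in>?p ` ?R. \<forall>i\<in>{0..<int n} - S. P i = y i"
      using imageI[OF x(1), of ?p] by (rule bexI)
  qed simp_all
  then show ?thesis using S by (simp add: check_positions_def punctured_cyclic_def)
qed

end


text \<open>The word of \<open>g \<mapsto> Tr (l g\<^bsup>n-s\<^esup>)\<close> has its spectrum supported on the cyclotomic coset of \<open>s\<close>.\<close>

lemma ex_word_phi_nonzero: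
  assumes \<rho>: "\<rho> < m" and s: "0 < s" "s < n" "\<rho> < wt s"
  obtains x where "x \<in> reed_muller (m - 1 - \<rho>) m" "phi s x \<noteq> (0::'a)"
proof -
  define J where "J = (\<lambda>i. {j \<in> {..<m}. (2 ^ j * s) mod n = i})"
  \<comment> \<open>The value \<open>phi s x\<close> will be \<open>poly p l\<close>. The term
    \<open>j = 0\<close> makes \<open>p\<close> nonzero, and its degree is smaller than the field,
    so some \<open>l\<close> is not a root.\<close>
  define p where "p = (\<Sum>j\<in>J s. monom (1::'a) (2 ^ j))"
  have m0: "0 < m" using \<rho> by simp
  have "0 \<in> J s" using m0 s by (simp add: J_def)
  have "coeff p 1 = (\<Sum>j\<in>J s. if j = 0 then 1 else 0)"
    unfolding p_def coeff_sum by (rule sum.cong) auto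
  also have "\<dots> = 1" using \<open>0 \<in> J s\<close> by (simp add: J_def)
  finally have "p \<noteq> 0" by auto
  have "degree p \<le> 2 ^ (m - 1)"
  proof (unfold p_def, rule degree_sum_le)
    fix j assume "j \<in> J s"
    then have "(2::nat) ^ j \<le> 2 ^ (m - 1)" by (intro power_increasing) (auto simp: J_def)
    then show "degree (monom (1::'a) (2 ^ j)) \<le> 2 ^ (m - 1)"
      using degree_monom_le order_trans by blast
  qed (simp add: J_def)
  also have "\<dots> < CARD('a)" unfolding card_field using m0 by (intro power_strict_increasing) auto
  finally have "{l. poly p l = 0} \<noteq> UNIV"
    using card_poly_roots_bound[OF \<open>p \<noteq> 0\<close>] by (metis not_le)
  then obtain l where l: "poly p l \<noteq> 0" by blast
  define h where "h = (\<lambda>g. \<Sum>j<m. (l * g ^ (n - s)) ^ (2 ^ j))"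
  \<comment> \<open>Squaring shifts the terms of a trace cyclically, because every element equals
    its \<open>2 ^ m\<close>-th power.\<close>
  have "h g ^ 2 = h g" for g
  proof -
    let ?z = "\<lambda>j. (l * g ^ (n - s)) ^ (2 ^ j)"
    have "h g ^ 2 = (\<Sum>j<m. ?z (Suc j))"
      unfolding h_def square_sum by (simp only: power_Suc2 power_mult)
    moreover have "?z 0 + (\<Sum>j<m. ?z (Suc j)) = (\<Sum>j<m. ?z j) + ?z m"
      by (rule trans[OF sum.lessThan_Suc_shift[of ?z m, symmetric] sum.lessThan_Suc])
    moreover have "?z 0 = ?z m" by (simp add: pow_card)
    ultimately show ?thesis by (simp add: h_def)
  qed
  then obtain x where x: "\<And>g. of_bit (x g) = h g" using ex_bit_word[of h] by blast
  have phi: "phi i x = (\<Sum>j\<in>J i. l ^ (2 ^ j))" if "i < n" for i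
  proof -
    have dvd: "n dvd (n - s) * 2 ^ j + i \<longleftrightarrow> (2 ^ j * s) mod n = i" for j
    proof -
      have "int ((n - s) * 2 ^ j + i) = int n * 2 ^ j + (int i - int (2 ^ j * s))"
        using s by (simp add: left_diff_distrib of_nat_diff mult.commute)
      then have "n dvd (n - s) * 2 ^ j + i \<longleftrightarrow> int n dvd int i - int (2 ^ j * s)"
        by (metis dvd_add_right_iff dvd_triv_left int_dvd_int_iff)
      also have "\<dots> \<longleftrightarrow> int i mod int n = int (2 ^ j * s) mod int n"
        by (simp add: mod_eq_dvd_iff)
      finally show ?thesis using that by (simp only: zmod_int[symmetric]) auto
    qed
    have "phi i x = (\<Sum>g\<in>UNIV. \<Sum>j<m. l ^ (2 ^ j) * g ^ ((n - s) * 2 ^ j + i))"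
      unfolding phi_def x h_def
      by (simp add: power_mult_distrib power_add sum_distrib_right mult.assoc flip: power_mult)
    also have "\<dots> = (\<Sum>j<m. l ^ (2 ^ j) * (\<Sum>g\<in>UNIV. g ^ ((n - s) * 2 ^ j + i)))"
      by (subst sum.swap) (simp add: sum_distrib_left)
    also have "\<dots> = (\<Sum>j<m. if (2 ^ j * s) mod n = i then l ^ (2 ^ j) else 0)"
      by (rule sum.cong[OF refl]) (use s in \<open>simp add: sum_powers dvd\<close>)
    also have "\<dots> = (\<Sum>j\<in>J i. l ^ (2 ^ j))"
      unfolding J_def by (rule sum.inter_filter[symmetric]) simp
    finally show ?thesis .
  qed
  have "wt ((2 ^ j * s) mod n) = wt s" for j
    using wt_double_pow_mod[of s m j] s by (simp add: n_eq)
  then have "J i = {}" if "wt i \<le> \<rho>" for i using that s by (auto simp: J_def)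
  then have "phi i x = 0" if "wt i \<le> \<rho>" "i < n" for i using that by (simp add: phi)
  then have "x \<in> reed_muller (m - 1 - \<rho>) m"
    using dual_reed_muller_iff[OF \<rho>] s by (simp add: low_weight_n)
  moreover have "phi s x \<noteq> 0" using l s by (simp add: phi p_def poly_sum poly_monom)
  ultimately show ?thesis by (rule that)
qed

text \<open>Evaluation at \<open>\<alpha> powi s\<close> runs over the nonzero positions and equals
  \<open>phi s\<close> for \<open>s > 0\<close>. Heavy exponents are excluded by the trace words.
  Exponent 0 is excluded by the all-one word, whose value there is \<open>n = 1\<close> in the
  field.\<close>

lemma punctured_defining_set:
  assumes \<rho>: "\<rho> < m"
  shows "cyclic_defining_set n \<alpha> (punctured_cyclic n \<alpha> (reed_muller (m - 1 - \<rho>) m))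
    = int ` low_weight m \<rho>"
proof -
  let ?R = "reed_muller (m - 1 - \<rho>) m :: ('a \<Rightarrow> bit) set"
  let ?p = "\<lambda>(x :: 'a \<Rightarrow> bit) i. if i \<in> {0..<int n} then x (\<alpha> powi i) else 0"
  have eval: "cyclic_eval n (?p x) (\<alpha> powi int s) = (\<Sum>g\<in>UNIV - {0}. of_bit (x g) * g ^ s)" for x s
  proof -
    have "cyclic_eval n (?p x) (\<alpha> powi int s) = (\<Sum>i\<in>{0..<int n}. of_bit (x (\<alpha> powi i)) * (\<alpha> powi i) ^ s)"
      unfolding cyclic_eval_def
      by (rule sum.cong) (auto simp: mult.commute simp flip: power_int_mult power_int_of_nat)
    also have "\<dots> = (\<Sum>k<n. of_bit (x (\<alpha> ^ k)) * (\<alpha> ^ k) ^ s)"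
      by (rule sum.reindex_bij_witness[of _ int nat]) (auto simp: power_int_def)
    also have "\<dots> = (\<Sum>g\<in>UNIV - {0}. of_bit (x g) * g ^ s)"
      by (rule sum.reindex_bij_betw[OF alpha_bij])
    finally show ?thesis .
  qed
  have phi: "(\<Sum>g\<in>UNIV - {0}. of_bit (x g) * g ^ s) = phi s x" if "0 < s" for s and x :: "'a \<Rightarrow> bit"
    unfolding phi_def by (rule sum.mono_neutral_left) (use that in \<open>auto simp: power_0_left\<close>)
  have "(\<forall>x\<in>?R. cyclic_eval n (?p x) (\<alpha> powi int s) = 0) \<longleftrightarrow> s \<in> low_weight m \<rho>" if sn: "s < n" for s
  proof
    assume s: "s \<in> low_weight m \<rho>"
    then have "0 < s" by (simp add: low_weight_n)
    show "\<forall>x\<in>?R. cyclic_eval n (?p x) (\<alpha> powi int s) = 0"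
      unfolding eval phi[OF \<open>0 < s\<close>] using dual_reed_muller_iff[OF \<rho>] s by blast
  next
    assume *: "\<forall>x\<in>?R. cyclic_eval n (?p x) (\<alpha> powi int s) = 0"
    show "s \<in> low_weight m \<rho>"
    proof (rule ccontr)
      assume "s \<notin> low_weight m \<rho>"
      then consider "s = 0" | "0 < s" "\<rho> < wt s" 
        using sn by (cases "s = 0") (auto simp: low_weight_n not_le)
      then show False
      proof cases
        case 1
        have "(\<lambda>_. 1) \<in> ?R"
          by (auto simp: reed_muller_n phi_def sum_powers dest: dvd_imp_le)
        with * have "(\<Sum>g\<in>UNIV - {0::'a}. 1 :: 'a) = 0" unfolding eval 1 by fastforce
        then show False using of_nat_n by (simp add: card_Diff_subset card_field exp_eq_Suc_n)
      next
        case 2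
        then obtain x where "x \<in> ?R" "phi s x \<noteq> (0::'a)"
          using ex_word_phi_nonzero[OF \<rho> _ sn] by blast
        then show False using * unfolding eval phi[OF 2(1)] by blast
      qed
    qed
  qed
  then have iff: "int s \<in> cyclic_defining_set n \<alpha> (?p ` ?R) \<longleftrightarrow> s \<in> low_weight m \<rho>" for s
    by (cases "s < n") (simp_all add: cyclic_defining_set_def low_weight_n)
  show ?thesis unfolding punctured_cyclic_def
  proof (rule Set.set_eqI)
    fix i
    show "i \<in> cyclic_defining_set n \<alpha> (?p ` ?R) \<longleftrightarrow> i \<in> int ` low_weight m \<rho>"
    proof (cases "0 \<le> i")
      case True
      then obtain s where "i = int s" by (rule nonneg_int_cases)
      then show ?thesis using iff[of s] by (simp only: inj_image_mem_iff[OF inj_of_nat])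
    next
      case False
      then show ?thesis by (auto simp: cyclic_defining_set_def)
    qed
  qed
qed

end

section \<open>Exponents of weight at most two\<close>

text \<open>Unordered pairs with repetition: a diagonal pair will encode the single power
  \<open>2 ^ (i + 1)\<close>, so one parametrization covers the weights one and two.\<close>

definition pairs :: "nat \<Rightarrow> (nat \<times> nat) set" where
  "pairs m = {(i, j). i \<le> j \<and> j < m}"

definition pair_residue :: "nat \<Rightarrow> nat \<times> nat \<Rightarrow> nat" where
  "pair_residue m p = (2 ^ fst p + 2 ^ snd p) mod (2 ^ m - 1)"

lemma finite_pairs [simp]: "finite (pairs m)"
  by (rule finite_subset[of _ "{..<m} \<times> {..<m}"]) (auto simp: pairs_def)

lemma card_strict_pairs: "card {(i, j). i < j \<and> j < m} = m * (m - 1) div 2"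
proof -
  have "{(i, j). i < j \<and> j < m} = prod.swap ` (SIGMA j:{..<m}. {..<j})" by force
  then have "card {(i, j). i < j \<and> j < m} = (\<Sum>j<m. j)"
    by (simp add: card_image)
  also have "\<dots> = m * (m - 1) div 2"
    by (cases m) (simp_all add: lessThan_Suc_atMost gauss_sum_nat atMost_atLeast0 mult.commute)
  finally show ?thesis .
qed

lemma card_pairs: "card (pairs m) = m * (m + 1) div 2"
proof -
  have "pairs m = prod.swap ` (SIGMA j:{..<m}. {..j})" by (force simp: pairs_def)
  then have "card (pairs m) = (\<Sum>j<m. Suc j)"
    by (simp add: card_image)
  also have "\<dots> = m * (m + 1) div 2"
    by (induction m) auto
  finally show ?thesis .
qed

lemma nat_eqI_bits: "{p. bit (s::nat) p} = {p. bit t p} \<Longrightarrow> s = t"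
  by (rule bit_eqI) blast

lemma bits_two_powers: "i < j \<Longrightarrow> {p. bit (2 ^ i + 2 ^ j :: nat) p} = {i, j}"
  by (subst disjunctive_add_eq_or) (auto intro!: bit_eqI simp: bit_and_iff bit_or_iff bit_exp_iff)

lemma bits_power: "{p. bit (2 ^ i :: nat) p} = {i}"
  by (auto simp: bit_simps)

text \<open>The diagonal pair at \<open>m - 1\<close> wraps around to the digit 0, hence
  \<open>Suc i mod m\<close>. For \<open>m = 2\<close> the strict pair gives 3, which reduces to 0;
  this case occurs later with \<open>a = 2\<close> in the role of \<open>m\<close>.\<close>

lemma bits_pair_residue:
  assumes m: "2 \<le> m" and p: "(i, j) \<in> pairs m"
  shows "{p. bit (pair_residue m (i, j)) p}
    = (if i < j then if m = 2 then {} else {i, j} else {Suc i mod m})"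
proof (cases "i < j")
  case True
  show ?thesis
  proof (cases "m = 2")
    case m2: True
    then have "i = 0" "j = 1" using True p by (auto simp: pairs_def)
    then show ?thesis using m2 by (simp add: pair_residue_def)
  next
    case False
    then obtain k where k: "m = Suc (Suc (Suc k))"
      using m by (metis add_2_eq_Suc le_Suc_ex not0_implies_Suc add_0_right)
    have "i \<le> Suc k" "j \<le> Suc (Suc k)" using True p k by (auto simp: pairs_def)
    then have "(2::nat) ^ i \<le> 2 ^ Suc k" "(2::nat) ^ j \<le> 2 ^ Suc (Suc k)"
      by (auto intro: power_increasing simp del: power_Suc)
    moreover have "(1::nat) \<le> 2 ^ k" by simp
    ultimately have "2 ^ i + 2 ^ j < (2 ^ m - 1 :: nat)" unfolding k power_Suc by linarith
    then show ?thesis using True False bits_two_powers[OF True] by (simp add: pair_residue_def)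
  qed
next
  case False
  then have ij: "j = i" "i < m" using p by (auto simp: pairs_def)
  have r: "pair_residue m (i, j) = 2 ^ Suc i mod (2 ^ m - 1)" by (simp add: pair_residue_def ij mult_2)
  obtain k where k: "m = Suc (Suc k)" using m by (metis add_2_eq_Suc le_Suc_ex)
  have "pair_residue m (i, j) = 2 ^ (Suc i mod m)"
  proof (cases "Suc i < m")
    case True
    then have "(2::nat) ^ Suc i \<le> 2 ^ Suc k" unfolding k by (intro power_increasing) auto
    moreover have "(1::nat) \<le> 2 ^ k" by simp
    ultimately have "2 ^ Suc i < (2 ^ m - 1 :: nat)" unfolding k power_Suc by linarith
    then show ?thesis using True by (simp add: r)
  next
    case False
    then have "Suc i = m" using ij by simp
    moreover have "(2::nat) ^ m = (2 ^ m - 1) + 1" by simp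
    moreover have "1 < (2 ^ m - 1 :: nat)"
      using one_le_power[of "2::nat" k] unfolding k power_Suc by linarith
    ultimately show ?thesis unfolding r by (metis mod_add_self1 mod_less mod_self power_0)
  qed
  then show ?thesis using False by (simp add: bits_power)
qed

text \<open>The set of binary digits recovers the pair. For \<open>m = 2\<close> there is just one
  strict pair, so its empty digit set causes no collision.\<close>

lemma inj_on_pair_residue:
  assumes "2 \<le> m"
  shows "inj_on (pair_residue m) (pairs m)"
proof (rule inj_onI, clarify)
  fix i j k l assume p: "(i, j) \<in> pairs m" "(k, l) \<in> pairs m"
    and eq: "pair_residue m (i, j) = pair_residue m (k, l)"
  have "(if i < j then if m = 2 then {} else {i, j} else {Suc i mod m})
      = (if k < l then if m = 2 then {} else {k, l} else {Suc k mod m})"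
    unfolding bits_pair_residue[OF assms p(1), symmetric] bits_pair_residue[OF assms p(2), symmetric] eq ..
  moreover have "i = k" if "Suc i mod m = Suc k mod m" "i < m" "k < m"
    using that assms by (auto simp: mod_Suc split: if_splits)
  ultimately show "i = k \<and> j = l" using p
    by (auto simp: pairs_def doubleton_eq_iff split: if_splits)
qed

text \<open>Diagonal pairs supply the exponents with one digit, strict pairs those with two;
  \<open>3 \<le> m\<close> keeps strict pairs away from the residue 0.\<close>

lemma low_weight_2:
  assumes m: "3 \<le> m"
  shows "low_weight m 2 = pair_residue m ` pairs m"
proof
  note bits = bits_pair_residue[of m]
  show "pair_residue m ` pairs m \<subseteq> low_weight m 2"
  proof (clarify)
    fix i j assume p: "(i, j) \<in> pairs m"
    have "{p. bit (pair_residue m (i, j)) p} \<noteq> {}" "wt (pair_residue m (i, j)) \<le> 2"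
      using bits[OF _ p] m by (auto simp: wt_def card_insert_if)
    moreover from this have "pair_residue m (i, j) \<noteq> 0" by (intro notI) simp
    moreover have "(0::nat) < 2 ^ m - 1" using m one_less_power[of "2::nat" m] by simp
    ultimately show "pair_residue m (i, j) \<in> low_weight m 2"
      by (simp add: low_weight_def pair_residue_def)
  qed
  show "low_weight m 2 \<subseteq> pair_residue m ` pairs m"
  proof
    fix s assume s: "s \<in> low_weight m 2"
    let ?B = "{p. bit s p}"
    have less: "p < m" if "bit s p" for p
    proof -
      have "s div 2 ^ p \<noteq> 0" using that by (auto simp: bit_iff_odd intro!: Nat.gr0I)
      then have "2 ^ p \<le> s" by (simp add: div_eq_0_iff)
      also have "s < 2 ^ m" using s by (auto simp: low_weight_def)
      finally show ?thesis by simp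
    qed
    have "?B \<noteq> {}" using s nat_eqI_bits[of s 0] by (auto simp: low_weight_def)
    then have "card ?B \<noteq> 0" using wt_finite by simp
    moreover have "card ?B \<le> 2" using s by (simp add: low_weight_def wt_def)
    ultimately consider "card ?B = 1" | "card ?B = 2" by linarith
    then have "\<exists>p\<in>pairs m. {q. bit (pair_residue m p) q} = ?B"
    proof cases
      case 1
      then obtain i where i: "?B = {i}" by (auto simp: card_1_singleton_iff)
      then have "i < m" using less[of i] by blast
      \<comment> \<open>The diagonal pair at \<open>k\<close> encodes \<open>2 ^ (k + 1)\<close>, so
        \<open>k\<close> is the cyclic predecessor of \<open>i\<close>.\<close>
      define k where "k = (if i = 0 then m - 1 else i - 1)"
      have "k < m" "Suc k mod m = i" using \<open>i < m\<close> m by (auto simp: k_def)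
      then show ?thesis using bits[of k k] m i by (intro bexI[of _ "(k, k)"]) (auto simp: pairs_def)
    next
      case 2
      then obtain i j where ij: "?B = {i, j}" "i \<noteq> j" by (auto simp: card_2_iff)
      then have lt: "i < m" "j < m" using less by blast+
      have "(min i j, max i j) \<in> pairs m" using lt by (auto simp: pairs_def)
      moreover have "{min i j, max i j} = {i, j}" "min i j < max i j" using ij(2) by (auto simp: min_def max_def)
      ultimately show ?thesis using bits[of "min i j" "max i j"] m ij by (intro bexI[of _ "(min i j, max i j)"]) auto
    qed
    then show "s \<in> pair_residue m ` pairs m" using nat_eqI_bits by blast
  qed
qed

lemma card_low_weight_2: "3 \<le> m \<Longrightarrow> card (low_weight m 2) = m * (m + 1) div 2"
  by (simp add: low_weight_2 card_image[OF inj_on_pair_residue] card_pairs)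

section \<open>Reduction of exponent pairs modulo \<open>a\<close>\<close>

definition reduce_pair :: "nat \<Rightarrow> nat \<times> nat \<Rightarrow> nat \<times> nat" where
  "reduce_pair a p = (min (fst p mod a) (snd p mod a), max (fst p mod a) (snd p mod a))"

lemma power_mod_exponent:
  fixes a i :: nat
  shows "2 ^ i mod (2 ^ a - 1) = 2 ^ (i mod a) mod (2 ^ a - 1 :: nat)"
proof -
  have "[2 ^ a = 1] (mod (2 ^ a - 1 :: nat))" by (simp add: cong_altdef_nat)
  then have "[(2 ^ a) ^ (i div a) * 2 ^ (i mod a) = 1 ^ (i div a) * 2 ^ (i mod a)] (mod (2 ^ a - 1 :: nat))"
    by (intro cong_mult cong_pow) auto
  then show ?thesis by (simp add: cong_def flip: power_mult power_add)
qed

lemma mersenne_dvd: "2 ^ a - 1 dvd (2 ^ (a * b) - 1 :: nat)"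
proof -
  have "[(2 ^ a) ^ b = 1 ^ b] (mod (2 ^ a - 1 :: nat))"
    by (rule cong_pow) (simp add: cong_altdef_nat)
  then show ?thesis by (simp add: cong_altdef_nat power_mult)
qed

text \<open>Modulo \<open>2 ^ a - 1\<close> the power \<open>2 ^ a\<close> is 1, so exponents count
  only modulo \<open>a\<close>. Sorting the reduced exponents with \<open>min\<close> and
  \<open>max\<close> leaves the sum unchanged.\<close>

lemma pair_residue_mod:
  "pair_residue (a * b) p mod (2 ^ a - 1) = pair_residue a (reduce_pair a p)"
proof -
  have "pair_residue (a * b) p mod (2 ^ a - 1) = (2 ^ fst p + 2 ^ snd p) mod (2 ^ a - 1)"
    unfolding pair_residue_def by (rule mod_mod_cancel[OF mersenne_dvd])
  also have "\<dots> = (2 ^ (fst p mod a) + 2 ^ (snd p mod a)) mod (2 ^ a - 1)"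
    by (metis mod_add_eq power_mod_exponent)
  also have "\<dots> = pair_residue a (reduce_pair a p)"
    by (simp add: pair_residue_def reduce_pair_def min_def max_def add.commute)
  finally show ?thesis .
qed

lemma reduce_pair_in: "0 < a \<Longrightarrow> reduce_pair a p \<in> pairs a"
  by (auto simp: reduce_pair_def pairs_def)

text \<open>The lifts of \<open>k\<close> below \<open>a * b\<close> are \<open>k + a * x\<close>
  with \<open>x < b\<close>. Over distinct residues the two lifts are independent; over equal
  residues the quotients again form an unordered pair with repetition.\<close>

lemma card_reduce_fibre:
  assumes "(k, l) \<in> pairs a"
  shows "card {p \<in> pairs (a * b). reduce_pair a p = (k, l)}
    = (if k < l then b ^ 2 else b * (b + 1) div 2)"
proof (cases "k < l")
  case True
  then have kl: "k < a" "l < a" "k \<noteq> l" using assms by (auto simp: pairs_def)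
  \<comment> \<open>Lifting may reverse the order, so \<open>?f\<close> sorts; \<open>?g\<close>
    tells the two components apart by their residues.\<close>
  let ?f = "\<lambda>(x, y). (min (k + a * x) (l + a * y), max (k + a * x) (l + a * y))"
  let ?g = "\<lambda>(i, j). if i mod a = k then (i div a, j div a) else (j div a, i div a)"
  have lt: "k + a * x < a * b" if "k < a" "x < b" for k x
  proof -
    have "k + a * x < a * Suc x" using that by simp
    also have "\<dots> \<le> a * b" using that by (intro mult_le_mono) auto
    finally show ?thesis .
  qed
  have "bij_betw ?f ({..<b} \<times> {..<b}) {p \<in> pairs (a * b). reduce_pair a p = (k, l)}"
  proof (rule bij_betw_byWitness[where f' = ?g])
    show "\<forall>p\<in>{..<b} \<times> {..<b}. ?g (?f p) = p"
      using kl by (auto simp: min_def max_def)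
    show "\<forall>p\<in>{p \<in> pairs (a * b). reduce_pair a p = (k, l)}. ?f (?g p) = p"
      using kl by (auto simp: reduce_pair_def pairs_def min_def max_def split: if_splits)
    show "?f ` ({..<b} \<times> {..<b}) \<subseteq> {p \<in> pairs (a * b). reduce_pair a p = (k, l)}"
    proof (rule image_subsetI)
      fix q assume "q \<in> {..<b} \<times> {..<b}"
      then obtain x y where q: "q = (x, y)" "x < b" "y < b" by auto
      then have "k + a * x < a * b" "l + a * y < a * b" using kl lt by auto
      then show "?f q \<in> {p \<in> pairs (a * b). reduce_pair a p = (k, l)}"
        using kl True q(1)
        by (cases "k + a * x \<le> l + a * y") (auto simp: reduce_pair_def pairs_def)
    qed
    show "?g ` {p \<in> pairs (a * b). reduce_pair a p = (k, l)} \<subseteq> {..<b} \<times> {..<b}"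
    proof (rule image_subsetI)
      fix p assume "p \<in> {p \<in> pairs (a * b). reduce_pair a p = (k, l)}"
      then obtain i j where p: "p = (i, j)" "i < a * b" "j < a * b" by (auto simp: pairs_def)
      have "i div a < b" "j div a < b" using p by (auto intro!: less_mult_imp_div_less simp: mult.commute)
      then show "?g p \<in> {..<b} \<times> {..<b}" by (simp add: p(1))
    qed
  qed
  then have "card {p \<in> pairs (a * b). reduce_pair a p = (k, l)} = card ({..<b} \<times> {..<b})"
    by (simp add: bij_betw_same_card)
  then show ?thesis using True by (simp add: power2_eq_square)
next
  case False
  then have kl: "l = k" "k < a" using assms by (auto simp: pairs_def)
  let ?f = "\<lambda>(x, y). (k + a * x, k + a * y)"
  let ?g = "\<lambda>(i, j). (i div a, j div a)"
  have "bij_betw ?f (pairs b) {p \<in> pairs (a * b). reduce_pair a p = (k, l)}"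
  proof (rule bij_betw_byWitness[where f' = ?g])
    show "\<forall>p\<in>pairs b. ?g (?f p) = p" using kl by auto
    show "\<forall>p\<in>{p \<in> pairs (a * b). reduce_pair a p = (k, l)}. ?f (?g p) = p"
      using kl by (auto simp: reduce_pair_def pairs_def min_def max_def split: if_splits) (metis mod_mult_div_eq)
    show "?f ` pairs b \<subseteq> {p \<in> pairs (a * b). reduce_pair a p = (k, l)}"
    proof (clarify)
      fix x y assume xy: "(x, y) \<in> pairs b"
      have "k + a * y < a * Suc y" using kl by simp
      also have "\<dots> \<le> a * b" using xy by (intro mult_le_mono) (auto simp: pairs_def)
      finally show "(k + a * x, k + a * y) \<in> pairs (a * b) \<and> reduce_pair a (k + a * x, k + a * y) = (k, l)"
        using xy kl by (auto simp: reduce_pair_def pairs_def)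
    qed
    show "?g ` {p \<in> pairs (a * b). reduce_pair a p = (k, l)} \<subseteq> pairs b"
    proof (rule image_subsetI)
      fix p assume "p \<in> {p \<in> pairs (a * b). reduce_pair a p = (k, l)}"
      then obtain i j where p: "p = (i, j)" "i \<le> j" "j < a * b" by (auto simp: pairs_def)
      have "j div a < b" using p by (auto intro!: less_mult_imp_div_less simp: mult.commute)
      then show "?g p \<in> pairs b" using p(2) by (simp add: p(1) pairs_def div_le_mono)
    qed
  qed
  then have "card {p \<in> pairs (a * b). reduce_pair a p = (k, l)} = card (pairs b)"
    by (simp add: bij_betw_same_card)
  then show ?thesis using False by (simp add: card_pairs)
qed

section \<open>Sizes of the residue classes modulo \<open>2 ^ a - 1\<close>\<close>

definition fibre :: "nat \<Rightarrow> nat \<Rightarrow> nat \<Rightarrow> nat set" where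
  "fibre m r u = {s \<in> low_weight m 2. s mod r = u}"

lemma card_fibre:
  assumes "2 \<le> a" "3 \<le> a * b" "(k, l) \<in> pairs a"
  shows "card (fibre (a * b) (2 ^ a - 1) (pair_residue a (k, l)))
    = (if k < l then b ^ 2 else b * (b + 1) div 2)"
proof -
  let ?P = "{p \<in> pairs (a * b). reduce_pair a p = (k, l)}"
  have inj: "inj_on (pair_residue a) (pairs a)" "inj_on (pair_residue (a * b)) (pairs (a * b))"
    by (rule inj_on_pair_residue; use assms(1,2) in linarith)+
  have "pair_residue (a * b) p mod (2 ^ a - 1) = pair_residue a (k, l) \<longleftrightarrow> reduce_pair a p = (k, l)" for p
    unfolding pair_residue_mod
    using inj_on_eq_iff[OF inj(1) reduce_pair_in assms(3)] assms(1) by simp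
  then have "fibre (a * b) (2 ^ a - 1) (pair_residue a (k, l)) = pair_residue (a * b) ` ?P"
    unfolding fibre_def low_weight_2[OF assms(2)] by blast
  moreover have "inj_on (pair_residue (a * b)) ?P" by (rule inj_on_subset[OF inj(2)]) auto
  ultimately show ?thesis using card_reduce_fibre[OF assms(3)] by (simp add: card_image)
qed

definition strict_residues :: "nat \<Rightarrow> nat set" where
  "strict_residues a = pair_residue a ` {(k, l). k < l \<and> l < a}"

definition equal_residues :: "nat \<Rightarrow> nat set" where
  "equal_residues a = pair_residue a ` {(k, l). k = l \<and> l < a}"

lemma residue_sets:
  assumes "2 \<le> a"
  shows "strict_residues a \<inter> equal_residues a = {}"
    "card (strict_residues a) = a * (a - 1) div 2" "card (equal_residues a) = a"
    "finite (strict_residues a)" "finite (equal_residues a)"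
proof -
  have sub: "{(k, l). k < l \<and> l < a} \<subseteq> pairs a" "{(k, l). k = l \<and> l < a} \<subseteq> pairs a"
    by (auto simp: pairs_def)
  then show "finite (strict_residues a)" "finite (equal_residues a)"
    unfolding strict_residues_def equal_residues_def
    by (metis finite_imageI finite_pairs finite_subset)+
  have inj: "inj_on (pair_residue a) (pairs a)" by (rule inj_on_pair_residue[OF assms])
  show "strict_residues a \<inter> equal_residues a = {}"
    unfolding strict_residues_def equal_residues_def
    by (subst inj_on_image_Int[OF inj sub, symmetric]) auto
  show "card (strict_residues a) = a * (a - 1) div 2"
    unfolding strict_residues_def
    by (simp add: card_image[OF inj_on_subset[OF inj sub(1)]] card_strict_pairs)
  have "{(k, l). k = l \<and> l < a} = (\<lambda>k. (k, k)) ` {..<a}" by auto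
  then have "card {(k, l). k = l \<and> l < a} = a" by (simp add: card_image inj_on_def)
  then show "card (equal_residues a) = a"
    unfolding equal_residues_def
    by (simp add: card_image[OF inj_on_subset[OF inj sub(2)]])
qed

lemma card_fibre_strict:
  assumes "2 \<le> a" "3 \<le> a * b" "u \<in> strict_residues a"
  shows "card (fibre (a * b) (2 ^ a - 1) u) = b ^ 2"
  using assms(3) card_fibre[OF assms(1,2)] by (auto simp: strict_residues_def pairs_def)

lemma card_fibre_equal:
  assumes "2 \<le> a" "3 \<le> a * b" "u \<in> equal_residues a"
  shows "card (fibre (a * b) (2 ^ a - 1) u) = b * (b + 1) div 2"
  using assms(3) card_fibre[OF assms(1,2)] by (auto simp: equal_residues_def pairs_def)

text \<open>Every class occurs, because a pair with entries below \<open>a\<close> is its own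
  reduction.\<close>

lemma low_weight_2_residues:
  assumes "2 \<le> a" "3 \<le> a * b"
  shows "(\<lambda>s. s mod (2 ^ a - 1)) ` low_weight (a * b) 2 = strict_residues a \<union> equal_residues a"
proof -
  have split: "strict_residues a \<union> equal_residues a = pair_residue a ` pairs a"
    unfolding strict_residues_def equal_residues_def image_Un[symmetric]
    by (rule arg_cong[where f = "image _"]) (auto simp: pairs_def)
  have "b \<noteq> 0" using assms(2) by (intro notI) simp
  have "pairs a \<subseteq> reduce_pair a ` pairs (a * b)"
  proof
    fix p assume "p \<in> pairs a"
    then obtain i j where p: "p = (i, j)" "i \<le> j" "j < a" by (auto simp: pairs_def)
    have "a \<le> a * b" using \<open>b \<noteq> 0\<close> by simp
    then have "j < a * b" using p(3) by (rule less_le_trans[rotated])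
    then have "p \<in> pairs (a * b)" "reduce_pair a p = p"
      using p by (auto simp: pairs_def reduce_pair_def)
    then show "p \<in> reduce_pair a ` pairs (a * b)" by force
  qed
  then have "reduce_pair a ` pairs (a * b) = pairs a" using reduce_pair_in assms(1) by fastforce
  then show ?thesis
    unfolding split low_weight_2[OF assms(2)] image_image pair_residue_mod
    by (metis image_image)
qed

section \<open>Restricted representatives\<close>

lemma mult_power_2_cancel:
  assumes "odd r"
  shows "(x * 2 ^ k) mod int r = (y * 2 ^ k) mod int r \<longleftrightarrow> x mod int r = y mod int r"
proof -
  have "coprime (2 ^ k) (int r)" using assms by simp
  then show ?thesis using cong_mult_rcancel[of "2 ^ k" "int r" x y] by (simp add: cong_def)
qed

lemma power_2_totient_mult:
  assumes "odd r" "totient r dvd i"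
  shows "(x * 2 ^ i) mod int r = x mod int r"
proof -
  obtain k where i: "i = totient r * k" using assms(2) by blast
  have "[2 ^ totient r = 1] (mod r)" using assms(1) by (intro euler_theorem) simp
  then have "[int (2 ^ totient r) = int 1] (mod int r)" by (simp only: cong_int_iff)
  then have "[(2 ^ totient r) ^ k = (1::int) ^ k] (mod int r)" by (intro cong_pow) simp
  then have "[x * 2 ^ i = x * 1] (mod int r)" unfolding i power_mult by (intro cong_mult) simp_all
  then show ?thesis by (simp add: cong_def)
qed

lemma cyclotomic_coset_1: "cyclotomic_coset 1 r e = range (\<lambda>i. (e * 2 ^ i) mod int r)"
  by (auto simp: cyclotomic_coset_def)

text \<open>Since 2 is invertible modulo odd \<open>r\<close>, the doubling orbit of
  \<open>e\<close> is purely periodic, and its least period \<open>d\<close> is its number of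
  elements. Euler's theorem supplies a period to start from.\<close>

lemma m1_period:
  assumes r: "odd r"
  shows "(e * 2 ^ i) mod int r = e mod int r \<longleftrightarrow> m1 r e dvd i"
proof -
  let ?f = "\<lambda>i. (e * 2 ^ i) mod int r"
  have shift: "?f (i + k) = ?f (j + k) \<longleftrightarrow> ?f i = ?f j" for i j k
    using mult_power_2_cancel[OF r, of "e * 2 ^ i" k "e * 2 ^ j"] by (simp add: power_add mult.assoc)
  have "0 < r" using r odd_pos by blast
  then have "0 < totient r \<and> ?f (totient r) = ?f 0"
    using power_2_totient_mult[OF r dvd_refl] by simp
  then have ex: "\<exists>d. 0 < d \<and> ?f d = ?f 0" by blast
  define d where "d = (LEAST d. 0 < d \<and> ?f d = ?f 0)"
  have d: "0 < d" "?f d = ?f 0" using LeastI_ex[OF ex] by (simp_all add: d_def)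
  have min: "\<not> (0 < k \<and> ?f k = ?f 0)" if "k < d" for k
    using that not_less_Least[of k] unfolding d_def by blast
  have period: "?f (k * d + i) = ?f i" for k i
  proof (induction k)
    case (Suc k)
    have "?f (Suc k * d + i) = ?f (d + (k * d + i))" by (simp add: add.assoc)
    also have "\<dots> = ?f (0 + (k * d + i))" using shift d(2) by blast
    finally show ?case using Suc by simp
  qed simp
  have mod: "?f (i mod d) = ?f i" for i
    using period[of "i div d" "i mod d"] by simp
  have dvd: "?f i = ?f 0 \<longleftrightarrow> d dvd i" for i
    using min[of "i mod d"] mod[of i] d(1) by (metis dvd_eq_mod_eq_0 gr0I mod_less_divisor)
  have "range ?f = ?f ` {..<d}"
    using mod d(1) by (auto intro!: image_eqI[of _ ?f "_ mod d"])
  moreover have "inj_on ?f {..<d}"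
  proof (rule linorder_inj_onI)
    fix i j assume ij: "i < j" "i \<in> {..<d}" "j \<in> {..<d}"
    have "?f (j - i) \<noteq> ?f 0" using ij dvd[of "j - i"] by (auto dest: dvd_imp_le)
    then show "?f i \<noteq> ?f j" using shift[of 0 i "j - i"] ij by simp
  qed auto
  ultimately have "m1 r e = d" unfolding m1_def cyclotomic_coset_1 by (simp add: card_image)
  then show ?thesis using dvd[of i] by simp
qed

locale restricted_representation =
  fixes r1 r2 :: nat and D Dbar :: "(int \<times> int) set"
  assumes odd: "odd r1" "odd r2" and D_pos: "D \<subseteq> positions r1 r2"
    and D_double: "(x, y) \<in> D \<Longrightarrow> ((2 * x) mod int r1, (2 * y) mod int r2) \<in> D"
    and rep: "restricted_representatives r1 r2 D Dbar"
begin

definition slice :: "int \<Rightarrow> int set" where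
  "slice u = {y. (u, y) \<in> D}"

lemma Dbar_sub: "Dbar \<subseteq> D"
  using rep unfolding restricted_representatives_def by (elim conjE)

lemma rep_orbit: "p \<in> D \<Longrightarrow> \<exists>!q. q \<in> Dbar \<and> q \<in> two_orbit r1 r2 p"
  using rep unfolding restricted_representatives_def by (elim conjE) (rule bspec)

lemma rep_coset: "a \<in> fst ` D \<Longrightarrow> \<exists>!e. e \<in> fst ` Dbar \<and> e \<in> cyclotomic_coset 1 r1 a"
  using rep unfolding restricted_representatives_def by (elim conjE) (rule bspec)

lemma D_mod: "(x, y) \<in> D \<Longrightarrow> x mod int r1 = x \<and> y mod int r2 = y"
  using D_pos by (auto simp: positions_def)

lemma finite_D: "finite D"
  using D_pos by (rule finite_subset) (simp add: positions_def)

lemma finite_slice: "finite (slice u)"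
proof (rule finite_subset)
  show "slice u \<subseteq> snd ` D" by (force simp: slice_def)
qed (simp add: finite_D)

lemma D_power: "(x, y) \<in> D \<Longrightarrow> ((x * 2 ^ i) mod int r1, (y * 2 ^ i) mod int r2) \<in> D"
proof (induction i)
  case (Suc i)
  from D_double[OF Suc.IH[OF Suc.prems]] show ?case
    by (simp add: mod_mult_right_eq ac_simps)
qed (use D_mod in simp)

text \<open>Doubling can be undone by further doubling: \<open>i + i * k\<close> is a multiple of
  both totients. This makes lying in the same coset or orbit symmetric.\<close>

lemma power_2_inverse:
  obtains k where "\<And>x. x mod int r1 = x \<Longrightarrow> ((x * 2 ^ i) mod int r1 * 2 ^ (i * k)) mod int r1 = x"
    and "\<And>y. y mod int r2 = y \<Longrightarrow> ((y * 2 ^ i) mod int r2 * 2 ^ (i * k)) mod int r2 = y"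
proof -
  have "0 < r1" "0 < r2" using odd odd_pos by blast+
  then have t: "0 < totient r1 * totient r2" by simp
  obtain k where k: "totient r1 * totient r2 = Suc k" using t gr0_implies_Suc by blast
  have "i + i * k = i * (totient r1 * totient r2)" unfolding k by simp
  then have dvd: "totient r1 dvd i + i * k" "totient r2 dvd i + i * k" by simp_all
  have "((x * 2 ^ i) mod int r * 2 ^ (i * k)) mod int r = x"
    if "odd r" "totient r dvd i + i * k" "x mod int r = x" for x r
    using power_2_totient_mult[OF that(1,2), of x] that(3)
    by (simp add: mod_mult_left_eq power_add mult.assoc)
  then show ?thesis using odd dvd by (intro that[of k]) blast+
qed

lemma fst_rep_unique:
  assumes "e \<in> fst ` Dbar" "e' \<in> fst ` Dbar" "e' \<in> cyclotomic_coset 1 r1 e"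
  shows "e' = e"
proof -
  have "e \<in> fst ` D" using assms(1) Dbar_sub by blast
  moreover from this have "e mod int r1 = e" using D_mod by auto
  then have "e \<in> cyclotomic_coset 1 r1 e" unfolding cyclotomic_coset_1
    by (intro image_eqI[of _ _ 0]) auto
  ultimately show ?thesis using rep_coset assms by blast
qed

text \<open>An orbit returns to the first coordinate \<open>e1\<close> exactly after multiples of
  \<open>m1 r1 e1\<close> doublings, which act on the second coordinate by powers of
  \<open>2 ^ m1 r1 e1\<close>.\<close>

lemma slice_eq_cosets:
  assumes e1: "e1 \<in> fst ` Dbar"
  shows "slice e1 = (\<Union>e2\<in>{e2. (e1, e2) \<in> Dbar}. cyclotomic_coset (m1 r1 e1) r2 e2)"
proof
  have e1_mod: "e1 mod int r1 = e1" using e1 Dbar_sub D_mod by auto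
  show "(\<Union>e2\<in>{e2. (e1, e2) \<in> Dbar}. cyclotomic_coset (m1 r1 e1) r2 e2) \<subseteq> slice e1"
  proof
    fix y assume "y \<in> (\<Union>e2\<in>{e2. (e1, e2) \<in> Dbar}. cyclotomic_coset (m1 r1 e1) r2 e2)"
    then obtain e2 i where e2: "(e1, e2) \<in> Dbar" "y = (e2 * 2 ^ (m1 r1 e1 * i)) mod int r2"
      by (auto simp: cyclotomic_coset_def)
    have "(e1 * 2 ^ (m1 r1 e1 * i)) mod int r1 = e1"
      using m1_period[OF odd(1), of e1 "m1 r1 e1 * i"] e1_mod by simp
    then show "y \<in> slice e1"
      using D_power[of e1 e2 "m1 r1 e1 * i"] Dbar_sub e2 by (auto simp: slice_def)
  qed
  show "slice e1 \<subseteq> (\<Union>e2\<in>{e2. (e1, e2) \<in> Dbar}. cyclotomic_coset (m1 r1 e1) r2 e2)"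
  proof
    fix y assume "y \<in> slice e1"
    then have y: "(e1, y) \<in> D" by (simp add: slice_def)
    obtain q where q: "q \<in> Dbar" "q \<in> two_orbit r1 r2 (e1, y)" using rep_orbit[OF y] by blast
    then obtain i where i: "q = ((e1 * 2 ^ i) mod int r1, (y * 2 ^ i) mod int r2)"
      by (auto simp: two_orbit_def)
    \<comment> \<open>Restrictedness enters here: the representative of the orbit could lie over
      another element of the coset of \<open>e1\<close>, but only one element of that coset is
      allowed.\<close>
    have "fst q \<in> cyclotomic_coset 1 r1 e1" unfolding cyclotomic_coset_1 i by auto
    then have "fst q = e1" using fst_rep_unique[OF e1] q(1) by blast
    then have "(e1 * 2 ^ i) mod int r1 = e1" by (simp add: i)
    then have "m1 r1 e1 dvd i" using m1_period[OF odd(1), of e1 i] e1_mod by simp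
    then obtain j where j: "i = m1 r1 e1 * j" by (rule dvdE)
    obtain k where "((y * 2 ^ i) mod int r2 * 2 ^ (i * k)) mod int r2 = y"
      using power_2_inverse[of i] D_mod[OF y] by metis
    then have "y = (snd q * 2 ^ (m1 r1 e1 * (j * k))) mod int r2" by (simp add: i j mult.assoc)
    then have "y \<in> cyclotomic_coset (m1 r1 e1) r2 (snd q)" by (auto simp: cyclotomic_coset_def)
    moreover have "(e1, snd q) \<in> Dbar" using q(1) \<open>fst q = e1\<close> by (metis prod.collapse)
    ultimately show "y \<in> (\<Union>e2\<in>{e2. (e1, e2) \<in> Dbar}. cyclotomic_coset (m1 r1 e1) r2 e2)" by blast
  qed
qed

text \<open>The cosets that make up the slice are disjoint, since a common element would put two
  representatives into one orbit. Hence \<open>M\<close> does not depend on the choice of second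
  coordinates.\<close>

lemma M_eq_card_slice:
  assumes e1: "e1 \<in> fst ` Dbar"
  shows "M r1 r2 Dbar e1 = card (slice e1)"
proof -
  let ?E = "{e2. (e1, e2) \<in> Dbar}"
  let ?C = "cyclotomic_coset (m1 r1 e1) r2"
  have e1_mod: "e1 mod int r1 = e1" using e1 Dbar_sub D_mod by auto
  have fin: "finite ?E"
    by (rule finite_subset[OF _ finite_slice[of e1]]) (use Dbar_sub in \<open>auto simp: slice_def\<close>)
  have in_orbit: "(e1, e2) \<in> two_orbit r1 r2 (e1, y)" if e2: "(e1, e2) \<in> Dbar" and y: "y \<in> ?C e2" for e2 y
  proof -
    obtain i where i: "y = (e2 * 2 ^ (m1 r1 e1 * i)) mod int r2"
      using y by (auto simp: cyclotomic_coset_def)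
    obtain k where k: "((e2 * 2 ^ (m1 r1 e1 * i)) mod int r2 * 2 ^ (m1 r1 e1 * i * k)) mod int r2 = e2"
      using power_2_inverse[of "m1 r1 e1 * i"] D_mod Dbar_sub e2 by (metis subsetD)
    moreover have "(e1 * 2 ^ (m1 r1 e1 * i * k)) mod int r1 = e1"
      using m1_period[OF odd(1), of e1 "m1 r1 e1 * i * k"] e1_mod by (simp add: mult.assoc)
    ultimately show ?thesis unfolding two_orbit_def i
      by (intro CollectI exI[of _ "m1 r1 e1 * i * k"]) simp
  qed
  have disj: "?C e2 \<inter> ?C e2' = {}" if "(e1, e2) \<in> Dbar" "(e1, e2') \<in> Dbar" "e2 \<noteq> e2'" for e2 e2'
  proof (rule ccontr)
    assume "?C e2 \<inter> ?C e2' \<noteq> {}"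
    then obtain y where y: "y \<in> ?C e2" "y \<in> ?C e2'" by blast
    then have "(e1, y) \<in> D" using slice_eq_cosets[OF e1] that(1) by (auto simp: slice_def)
    from rep_orbit[OF this] in_orbit[OF that(1) y(1)] in_orbit[OF that(2) y(2)] that
    show False by blast
  qed
  have "finite (?C e2)" if "e2 \<in> ?E" for e2
    by (rule finite_subset[OF _ finite_slice[of e1]]) (use slice_eq_cosets[OF e1] that in blast)
  then have "card (slice e1) = (\<Sum>e2\<in>?E. card (?C e2))"
    unfolding slice_eq_cosets[OF e1] using fin disj by (intro card_UN_disjoint) auto
  then show ?thesis by (simp add: M_def m2_def)
qed

lemma card_slice_le:
  assumes "x \<in> fst ` D"
  shows "card (slice x) \<le> card (slice ((x * 2 ^ i) mod int r1))"
proof (rule card_inj_on_le[of "\<lambda>y. (y * 2 ^ i) mod int r2"])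
  show "inj_on (\<lambda>y. (y * 2 ^ i) mod int r2) (slice x)"
  proof (rule inj_onI)
    fix y z assume "y \<in> slice x" "z \<in> slice x" "(y * 2 ^ i) mod int r2 = (z * 2 ^ i) mod int r2"
    then show "y = z" using mult_power_2_cancel[OF odd(2)] D_mod by (metis mem_Collect_eq slice_def)
  qed
  show "(\<lambda>y. (y * 2 ^ i) mod int r2) ` slice x \<subseteq> slice ((x * 2 ^ i) mod int r1)"
    using D_power by (auto simp: slice_def)
qed (rule finite_slice)

text \<open>Multiplication by a power of 2 injects one slice into the other, and a further power
  leads back.\<close>

lemma card_slice_coset:
  assumes x: "x \<in> fst ` D" and u: "u \<in> cyclotomic_coset 1 r1 x"
  shows "card (slice u) = card (slice x)"
proof -
  obtain i where i: "u = (x * 2 ^ i) mod int r1" using u unfolding cyclotomic_coset_1 by blast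
  have "u \<in> fst ` D" using x D_power by (force simp: i)
  have "x mod int r1 = x" using x D_mod by auto
  then obtain k where "(u * 2 ^ (i * k)) mod int r1 = x" using power_2_inverse[of i] i by metis
  then show ?thesis
    using card_slice_le[OF \<open>u \<in> fst ` D\<close>, of "i * k"] card_slice_le[OF x, of i] i by simp
qed

lemma fst_D_rep:
  assumes u: "u \<in> fst ` D"
  obtains e where "e \<in> fst ` Dbar" "u \<in> cyclotomic_coset 1 r1 e"
proof -
  obtain e where e: "e \<in> fst ` Dbar" "e \<in> cyclotomic_coset 1 r1 u" using rep_coset[OF u] by blast
  then obtain i where i: "e = (u * 2 ^ i) mod int r1" unfolding cyclotomic_coset_1 by blast
  have "u mod int r1 = u" using u D_mod by auto
  then obtain k where "(e * 2 ^ (i * k)) mod int r1 = u" using power_2_inverse[of i] i by metis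
  then have "u \<in> cyclotomic_coset 1 r1 e" unfolding cyclotomic_coset_1 by blast
  then show ?thesis using that e(1) by blast
qed

lemma coset_subset_fst_D: "e \<in> fst ` Dbar \<Longrightarrow> cyclotomic_coset 1 r1 e \<subseteq> fst ` D"
proof
  fix u assume e: "e \<in> fst ` Dbar" and u: "u \<in> cyclotomic_coset 1 r1 e"
  obtain y where "(e, y) \<in> D" using e Dbar_sub by auto
  moreover obtain i where "u = (e * 2 ^ i) mod int r1"
    using u unfolding cyclotomic_coset_1 by blast
  ultimately have "(u, (y * 2 ^ i) mod int r2) \<in> D" using D_power by simp
  then show "u \<in> fst ` D" by (rule image_eqI[rotated]) simp
qed

lemma M_image: "M r1 r2 Dbar ` fst ` Dbar = (\<lambda>u. card (slice u)) ` fst ` D"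
proof
  show "M r1 r2 Dbar ` fst ` Dbar \<subseteq> (\<lambda>u. card (slice u)) ` fst ` D"
  proof (rule image_subsetI)
    fix e assume e: "e \<in> fst ` Dbar"
    then have "e \<in> fst ` D" using Dbar_sub by blast
    then show "M r1 r2 Dbar e \<in> (\<lambda>u. card (slice u)) ` fst ` D"
      unfolding M_eq_card_slice[OF e] by (rule imageI)
  qed
  show "(\<lambda>u. card (slice u)) ` fst ` D \<subseteq> M r1 r2 Dbar ` fst ` Dbar"
  proof (rule image_subsetI)
    fix u assume u: "u \<in> fst ` D"
    obtain e where e: "e \<in> fst ` Dbar" "u \<in> cyclotomic_coset 1 r1 e" using fst_D_rep[OF u] by blast
    then have "e \<in> fst ` D" using Dbar_sub by blast
    from card_slice_coset[OF this e(2)] have "card (slice u) = M r1 r2 Dbar e"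
      by (simp only: M_eq_card_slice[OF e(1)])
    then show "card (slice u) \<in> M r1 r2 Dbar ` fst ` Dbar" using e(1) by (rule image_eqI)
  qed
qed

text \<open>The cosets of the representatives partition the first projection of \<open>D\<close>,
  and the slice size is constant on each of them.\<close>

lemma sum_m1_eq_card:
  "(\<Sum>e1\<in>{e1 \<in> fst ` Dbar. M r1 r2 Dbar e1 \<ge> f}. m1 r1 e1)
    = card {u \<in> fst ` D. card (slice u) \<ge> f}"
proof -
  let ?E = "{e1 \<in> fst ` Dbar. M r1 r2 Dbar e1 \<ge> f}"
  have sub: "fst ` Dbar \<subseteq> fst ` D" using Dbar_sub by blast
  have un: "{u \<in> fst ` D. card (slice u) \<ge> f} = (\<Union>e\<in>?E. cyclotomic_coset 1 r1 e)"
  proof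
    show "{u \<in> fst ` D. card (slice u) \<ge> f} \<subseteq> (\<Union>e\<in>?E. cyclotomic_coset 1 r1 e)"
    proof
      fix u assume u: "u \<in> {u \<in> fst ` D. card (slice u) \<ge> f}"
      obtain e where e: "e \<in> fst ` Dbar" "u \<in> cyclotomic_coset 1 r1 e" using fst_D_rep u by blast
      then have "card (slice u) = card (slice e)" using card_slice_coset sub by blast
      then have "e \<in> ?E" using u e(1) M_eq_card_slice[OF e(1)] by simp
      then show "u \<in> (\<Union>e\<in>?E. cyclotomic_coset 1 r1 e)" using e(2) by blast
    qed
    show "(\<Union>e\<in>?E. cyclotomic_coset 1 r1 e) \<subseteq> {u \<in> fst ` D. card (slice u) \<ge> f}"
    proof
      fix u assume "u \<in> (\<Union>e\<in>?E. cyclotomic_coset 1 r1 e)"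
      then obtain e where e: "e \<in> fst ` Dbar" "M r1 r2 Dbar e \<ge> f" "u \<in> cyclotomic_coset 1 r1 e"
        by blast
      have "card (slice u) = card (slice e)" using card_slice_coset[OF _ e(3)] sub e(1) by blast
      then show "u \<in> {u \<in> fst ` D. card (slice u) \<ge> f}"
        using coset_subset_fst_D[OF e(1)] e M_eq_card_slice[OF e(1)] by auto
    qed
  qed
  have disj: "cyclotomic_coset 1 r1 e \<inter> cyclotomic_coset 1 r1 e' = {}"
    if "e \<in> fst ` Dbar" "e' \<in> fst ` Dbar" "e \<noteq> e'" for e e'
  proof (rule ccontr)
    assume "cyclotomic_coset 1 r1 e \<inter> cyclotomic_coset 1 r1 e' \<noteq> {}"
    then obtain u where u: "u \<in> cyclotomic_coset 1 r1 e" "u \<in> cyclotomic_coset 1 r1 e'" by blast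
    have rev: "x \<in> cyclotomic_coset 1 r1 u" if x: "u \<in> cyclotomic_coset 1 r1 x" "x \<in> fst ` Dbar" for x
    proof -
      obtain i where i: "u = (x * 2 ^ i) mod int r1" using x(1) unfolding cyclotomic_coset_1 by blast
      have "x mod int r1 = x" using x(2) sub D_mod by auto
      then obtain k where "(u * 2 ^ (i * k)) mod int r1 = x" using power_2_inverse[of i] i by metis
      then show ?thesis unfolding cyclotomic_coset_1 by blast
    qed
    have "u \<in> fst ` D" using coset_subset_fst_D[OF that(1)] u(1) by blast
    from rep_coset[OF this] rev[OF u(1) that(1)] rev[OF u(2) that(2)] that show False by blast
  qed
  have "finite ?E" by (rule finite_subset[of _ "fst ` D"]) (use sub finite_D in auto)
  moreover have "finite (cyclotomic_coset 1 r1 e)" if "e \<in> ?E" for e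
    by (rule finite_subset[of _ "fst ` D"]) (use coset_subset_fst_D that finite_D in auto)
  ultimately have "card (\<Union>e\<in>?E. cyclotomic_coset 1 r1 e) = (\<Sum>e\<in>?E. card (cyclotomic_coset 1 r1 e))"
    using disj by (intro card_UN_disjoint) auto
  then show ?thesis unfolding un m1_def by simp
qed

text \<open>With representatives eliminated, the \<open>f\<close> values are the slice sizes in
  decreasing order and the \<open>g\<close> values count first coordinates with large enough slices.
  The value 0 at index 3 is the lower end of the last strip of \<open>Gamma_set\<close>.\<close>

lemma two_valued_sequences:
  assumes D: "fst ` D = A \<union> B" and disj: "A \<inter> B = {}" and ne: "A \<noteq> {}" "B \<noteq> {}"
    and A: "\<And>u. u \<in> A \<Longrightarrow> card (slice u) = f1" and B: "\<And>u. u \<in> B \<Longrightarrow> card (slice u) = f2"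
    and f: "0 < f2" "f2 < f1"
  shows "s_len r1 r2 Dbar = 2" "f_seq r1 r2 Dbar 1 = f1" "f_seq r1 r2 Dbar 2 = f2"
    "f_seq r1 r2 Dbar 3 = 0" "g_seq r1 r2 Dbar 1 = card A" "g_seq r1 r2 Dbar 2 = card A + card B"
proof -
  have "(\<lambda>u. card (slice u)) ` A = (\<lambda>_. f1) ` A" by (rule image_cong[OF refl A])
  then have imA: "(\<lambda>u. card (slice u)) ` A = {f1}" using ne(1) by (simp only: image_constant_conv if_False)
  have "(\<lambda>u. card (slice u)) ` B = (\<lambda>_. f2) ` B" by (rule image_cong[OF refl B])
  then have imB: "(\<lambda>u. card (slice u)) ` B = {f2}" using ne(2) by (simp only: image_constant_conv if_False)
  have M: "M r1 r2 Dbar ` fst ` Dbar = {f2, f1}" unfolding M_image D image_Un imA imB by auto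
  show s: "s_len r1 r2 Dbar = 2" using f by (simp add: s_len_def M)
  have sorted: "sorted_list_of_set {f2, f1} = [f2, f1]"
    using f sorted_list_of_set.idem_if_sorted_distinct[of "[f2, f1]"] by simp
  show f1: "f_seq r1 r2 Dbar 1 = f1" and f2: "f_seq r1 r2 Dbar 2 = f2" and "f_seq r1 r2 Dbar 3 = 0"
    by (simp_all add: f_seq_def s M sorted)
  have fin: "finite A" "finite B" using finite_D D by (metis finite_imageI finite_Un)+
  have "{u \<in> fst ` D. card (slice u) \<ge> f1} = A" unfolding D using A B f by auto
  then show "g_seq r1 r2 Dbar 1 = card A" unfolding g_seq_def f1 sum_m1_eq_card by simp
  have "{u \<in> fst ` D. card (slice u) \<ge> f2} = A \<union> B" unfolding D using A B f by auto
  then show "g_seq r1 r2 Dbar 2 = card A + card B" unfolding g_seq_def f2 sum_m1_eq_card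
    using disj fin by (simp add: card_Un_disjoint)
qed

end

section \<open>Invertibility on the staircase of exponents\<close>

locale two_roots = char2_field m n \<alpha> for m n and \<alpha> :: "'a::{field,finite}" +
  fixes a b r1 r2 :: nat and \<beta>1 \<beta>2 :: 'a
  assumes m_eq: "m = a * b" and r1_eq: "r1 = 2 ^ a - 1" and a2: "2 \<le> a" and b2: "2 \<le> b"
    and n_prod: "n = r1 * r2" and cop: "coprime r1 r2"
    and \<beta>1: "primitive_root_of_unity r1 \<beta>1" and \<beta>2: "primitive_root_of_unity r2 \<beta>2"
begin

text \<open>The staircase \<open>\<Gamma>\<close> in natural numbers, cut along the first
  coordinate.\<close>

definition exponents :: "(nat \<times> nat) set" where
  "exponents = {..<a * (a - 1) div 2} \<times> {..<b ^ 2}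
     \<union> {a * (a - 1) div 2..<a * (a + 1) div 2} \<times> {..<b * (b + 1) div 2}"

definition monomial :: "nat \<times> nat \<Rightarrow> 'a" where
  "monomial p = \<beta>1 ^ fst p * \<beta>2 ^ snd p"

lemma m4: "4 \<le> m"
  using mult_le_mono[OF a2 b2] m_eq by simp

lemma r_pos: "0 < r1" "0 < r2"
  using \<beta>1 \<beta>2 by (simp_all add: primitive_root_of_unity_def)

lemma \<beta>_pow: "\<beta>1 ^ r1 = 1" "\<beta>2 ^ r2 = 1"
  using \<beta>1 \<beta>2 by (simp_all add: primitive_root_of_unity_def)

lemma monomial_nz: "monomial p \<noteq> 0"
  using \<beta>_pow r_pos by (auto simp: monomial_def power_0_left)

text \<open>Raising to the power \<open>r2\<close> removes the second factor, and coprimality then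
  recovers the first exponent; \<open>r1\<close> does the same for the second.\<close>

lemma monomial_inj: "inj_on monomial ({..<r1} \<times> {..<r2})"
proof (rule inj_onI, clarify)
  fix i j k l
  assume lt: "i < r1" "j < r2" "k < r1" "l < r2" and eq: "monomial (i, j) = monomial (k, l)"
  have one: "(\<beta>2 ^ j) ^ r2 = 1" "(\<beta>1 ^ j) ^ r1 = 1" for j
    by (metis \<beta>_pow mult.commute power_mult power_one)+
  have "monomial (i, j) ^ r2 = \<beta>1 ^ (i * r2)" for i j
    by (simp add: monomial_def power_mult_distrib power_mult one)
  then have "[i * r2 = k * r2] (mod r1)" using eq primitive_power_eq_iff[OF \<beta>1] by (metis cong_def)
  then have "i = k" using cop lt
    by (simp add: cong_mult_rcancel_nat coprime_commute cong_less_modulus_unique_nat)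
  moreover have "monomial (i, j) ^ r1 = \<beta>2 ^ (j * r1)" for i j
    by (simp add: monomial_def power_mult_distrib power_mult one)
  then have "[j * r1 = l * r1] (mod r2)" using eq primitive_power_eq_iff[OF \<beta>2] by (metis cong_def)
  then have "j = l" using cop lt
    by (simp add: cong_mult_rcancel_nat coprime_commute cong_less_modulus_unique_nat)
  ultimately show "i = k \<and> j = l" by simp
qed

lemma crt_unique: "s < n \<Longrightarrow> t < n \<Longrightarrow> s mod r1 = t mod r1 \<Longrightarrow> s mod r2 = t mod r2 \<Longrightarrow> s = t"
  using coprime_cong_mult_nat[OF _ _ cop, of s t] n_prod
  by (auto simp: cong_def)

lemma residues_less: "u \<in> strict_residues a \<union> equal_residues a \<Longrightarrow> u < r1"
  using r_pos(1) by (auto simp: strict_residues_def equal_residues_def pair_residue_def r1_eq)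

lemmas residues = residue_sets[OF a2]

lemma m3: "3 \<le> a * b" using m4 m_eq by simp

lemma card_fibre_le: "card (fibre m r1 u) \<le> r2"
proof -
  have "inj_on (\<lambda>s. s mod r2) (fibre m r1 u)"
    by (rule inj_onI) (auto simp: fibre_def low_weight_n intro: crt_unique)
  then have "card (fibre m r1 u) \<le> card {..<r2}"
    by (rule card_inj_on_le) (use r_pos in auto)
  then show ?thesis by simp
qed

lemma fibre_strict: "u \<in> strict_residues a \<Longrightarrow> card (fibre m r1 u) = b ^ 2"
  and fibre_equal: "u \<in> equal_residues a \<Longrightarrow> card (fibre m r1 u) = b * (b + 1) div 2"
  using card_fibre_strict[OF a2 m3] card_fibre_equal[OF a2 m3] by (simp_all add: m_eq r1_eq)

lemma triangle_split: "a * (a - 1) div 2 + a = a * (a + 1) div 2"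
proof -
  obtain k where "a = Suc k" using a2 by (metis Suc_le_D numeral_2_eq_2)
  then show ?thesis by simp
qed

lemma strict_nonempty: "strict_residues a \<noteq> {}" and equal_nonempty: "equal_residues a \<noteq> {}"
proof -
  have "(0, 1) \<in> {(k, l). k < l \<and> l < a}" "(0, 0) \<in> {(k, l). k = l \<and> l < a}" using a2 by auto
  then show "strict_residues a \<noteq> {}" "equal_residues a \<noteq> {}"
    unfolding strict_residues_def equal_residues_def by blast+
qed

lemma triangle_less_square: "0 < b * (b + 1) div 2" "b * (b + 1) div 2 < b ^ 2"
proof -
  obtain c where c: "b = c + 2" using b2 by (metis add.commute le_Suc_ex)
  show "0 < b * (b + 1) div 2" "b * (b + 1) div 2 < b ^ 2"
    unfolding c by (simp_all add: power2_eq_square algebra_simps)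
qed

text \<open>The sides of the staircase count residues: a fibre over one class modulo
  \<open>r1\<close> injects into the residues modulo \<open>r2\<close>, and the classes themselves
  are residues modulo \<open>r1\<close>.\<close>

lemma exponents_subset: "exponents \<subseteq> {..<r1} \<times> {..<r2}"
proof -
  obtain u where "u \<in> strict_residues a" using strict_nonempty by blast
  then have "b ^ 2 \<le> r2" using card_fibre_le[of u] fibre_strict by simp
  moreover have "card (strict_residues a \<union> equal_residues a) \<le> card {..<r1}"
    using residues_less by (intro card_mono) auto
  then have "a * (a + 1) div 2 \<le> r1"
    using residues triangle_split by (simp add: card_Un_disjoint)
  ultimately show ?thesis
    using triangle_split triangle_less_square(2) by (auto simp: exponents_def)
qed

text \<open>Both counts equal \<open>ab(ab + 1) / 2\<close>, because
  \<open>(a - 1)b + (b + 1) = ab + 1\<close>. The identity is checked after doubling, which clears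
  the integer divisions.\<close>

lemma card_exponents: "card exponents = card (low_weight m 2)"
proof -
  have even: "2 * (k * (k + 1) div 2) = k * (k + 1)" for k :: nat by simp
  have "card exponents = a * (a - 1) div 2 * b ^ 2 + a * (b * (b + 1) div 2)"
  proof -
    have d: "a * (a + 1) div 2 - a * (a - 1) div 2 = a" using triangle_split by linarith
    have "card exponents = card ({..<a * (a - 1) div 2} \<times> {..<b ^ 2})
        + card ({a * (a - 1) div 2..<a * (a + 1) div 2} \<times> {..<b * (b + 1) div 2})"
      unfolding exponents_def by (rule card_Un_disjoint) auto
    then show ?thesis
      by (simp only: card_cartesian_product card_lessThan card_atLeastLessThan d)
  qed
  moreover have "2 * (a * (a - 1) div 2 * b ^ 2 + a * (b * (b + 1) div 2)) = m * (m + 1)"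
  proof -
    obtain k where k: "a = Suc k" using a2 by (metis Suc_le_D numeral_2_eq_2)
    have "2 * (a * (a - 1) div 2) = a * (a - 1)" using even[of k] by (simp add: k mult.commute)
    then have "2 * (a * (a - 1) div 2 * b ^ 2 + a * (b * (b + 1) div 2))
        = a * (a - 1) * b ^ 2 + a * (b * (b + 1))"
      using even[of b] by (metis distrib_left mult.assoc mult.left_commute)
    also have "\<dots> = m * (m + 1)" unfolding m_eq k by (simp add: power2_eq_square algebra_simps)
    finally show ?thesis .
  qed
  ultimately have "2 * card exponents = m * (m + 1)" by simp
  moreover have "card (low_weight m 2) = m * (m + 1) div 2" using m4 by (simp add: card_low_weight_2)
  ultimately show ?thesis by simp
qed

lemma monomial_inj_exponents: "inj_on monomial exponents"
  by (rule inj_on_subset[OF monomial_inj exponents_subset])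

lemma card_monomials: "card (monomial ` exponents) = card (low_weight m 2)"
  using card_exponents card_image[OF monomial_inj_exponents] by simp

text \<open>Interpolation at the points of \<open>D\<close>: their first coordinates are indexed by
  the residue classes modulo \<open>r1\<close>, and by the Chinese remainder theorem the points
  above one class are as many as its fibre.\<close>

lemma monomials_injective:
  assumes w: "\<forall>s\<in>low_weight m 2. (\<Sum>g\<in>monomial ` exponents. w g * g ^ s) = 0"
  shows "\<forall>g\<in>monomial ` exponents. w g = 0"
proof -
  let ?g1 = "a * (a - 1) div 2" and ?g2 = "a * (a + 1) div 2"
  let ?f1 = "b ^ 2" and ?f2 = "b * (b + 1) div 2"
  define P where "P = (\<lambda>i j. w (monomial (i, j)))"
  define D where "D = (\<lambda>s. (\<beta>1 ^ s, \<beta>2 ^ s)) ` low_weight m 2"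
  have inj1: "inj_on (\<lambda>u. \<beta>1 ^ u) (strict_residues a \<union> equal_residues a)"
    by (rule inj_onI) (use residues_less in \<open>simp add: primitive_power_eq_iff[OF \<beta>1]\<close>)
  have cards: "card {v. (\<beta>1 ^ u, v) \<in> D} = card (fibre m r1 u)"
    if "u \<in> strict_residues a \<union> equal_residues a" for u
  proof -
    have "u mod r1 = u" using residues_less[OF that] by simp
    then have "{v. (\<beta>1 ^ u, v) \<in> D} = (\<lambda>s. \<beta>2 ^ s) ` fibre m r1 u"
      by (auto simp: D_def fibre_def primitive_power_eq_iff[OF \<beta>1])
    moreover have "inj_on (\<lambda>s. \<beta>2 ^ s) (fibre m r1 u)"
      by (rule inj_onI)
        (auto simp: fibre_def low_weight_n primitive_power_eq_iff[OF \<beta>2] intro: crt_unique)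
    ultimately show ?thesis by (simp add: card_image)
  qed
  have main: "(i < ?g1 \<longrightarrow> j < ?f1 \<longrightarrow> P i j = 0) \<and> (i < ?g2 \<longrightarrow> j < ?f2 \<longrightarrow> P i j = 0)" for i j
  proof (rule two_step_interpolation[where D = D
        and A = "(\<lambda>u. \<beta>1 ^ u) ` strict_residues a" and B = "(\<lambda>u. \<beta>1 ^ u) ` equal_residues a"])
    show "finite D" by (simp add: D_def)
    show "(\<lambda>u. \<beta>1 ^ u) ` strict_residues a \<inter> (\<lambda>u. \<beta>1 ^ u) ` equal_residues a = {}"
      using inj_on_image_Int[OF inj1, of "strict_residues a" "equal_residues a"] residues(1) by simp
    show "?f1 \<le> card {v. (u, v) \<in> D}" if "u \<in> (\<lambda>u. \<beta>1 ^ u) ` strict_residues a" for u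
      using that cards fibre_strict by auto
    show "?f2 \<le> card {v. (u, v) \<in> D}" if "u \<in> (\<lambda>u. \<beta>1 ^ u) ` equal_residues a" for u
      using that cards fibre_equal by auto
    show "?f2 \<le> ?f1" using triangle_less_square(2) by simp
    have cs: "card ((\<lambda>u. \<beta>1 ^ u) ` strict_residues a) = ?g1" "card ((\<lambda>u. \<beta>1 ^ u) ` equal_residues a) = a"
      using residues(2,3) by (simp_all add: card_image inj_on_subset[OF inj1])
    show "?g1 = card ((\<lambda>u. \<beta>1 ^ u) ` strict_residues a)"
      "?g2 = card ((\<lambda>u. \<beta>1 ^ u) ` strict_residues a) + card ((\<lambda>u. \<beta>1 ^ u) ` equal_residues a)"
      unfolding cs triangle_split by simp_all
    fix u v assume "(u, v) \<in> D"
    then obtain s where s: "s \<in> low_weight m 2" "u = \<beta>1 ^ s" "v = \<beta>2 ^ s" by (auto simp: D_def)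
    \<comment> \<open>The roles are exchanged here: the exponent pair of a row becomes the degree of
      a term, and \<open>s\<close> selects the point.\<close>
    have pow: "monomial p ^ s = u ^ fst p * v ^ snd p" for p
      by (simp add: monomial_def power_mult_distrib s(2,3) mult.commute flip: power_mult)
    have "0 = (\<Sum>g\<in>monomial ` exponents. w g * g ^ s)" using w s(1) by simp
    also have "\<dots> = (\<Sum>p\<in>exponents. w (monomial p) * monomial p ^ s)"
      by (rule sum.reindex[OF monomial_inj_exponents, unfolded o_def])
    also have "\<dots> = (\<Sum>p\<in>exponents. P (fst p) (snd p) * u ^ fst p * v ^ snd p)"
      unfolding pow by (simp add: P_def mult.assoc)
    also have "\<dots> = (\<Sum>p\<in>{..<?g1} \<times> {..<?f1}. P (fst p) (snd p) * u ^ fst p * v ^ snd p)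
        + (\<Sum>p\<in>{?g1..<?g2} \<times> {..<?f2}. P (fst p) (snd p) * u ^ fst p * v ^ snd p)"
      unfolding exponents_def by (rule sum.union_disjoint) auto
    finally show "(\<Sum>i<?g1. \<Sum>j<?f1. P i j * u ^ i * v ^ j)
        + (\<Sum>i=?g1..<?g2. \<Sum>j<?f2. P i j * u ^ i * v ^ j) = 0"
      by (simp add: sum.cartesian_product case_prod_unfold)
  qed (use residues in auto)
  show ?thesis
  proof
    fix g assume "g \<in> monomial ` exponents"
    then obtain i j where "(i, j) \<in> exponents" "g = monomial (i, j)" by auto
    then show "w g = 0" using main[of i j] by (auto simp: P_def exponents_def)
  qed
qed

lemma zero_notin_monomials: "0 \<notin> monomial ` exponents"
  using monomial_nz by (metis imageE)

lemma two_less_m: "2 < m" and m_minus: "m - 1 - 2 = m - 3"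
  using m4 by simp_all

lemma monomial_information_set:
  "information_set UNIV (reed_muller 2 m) (insert 0 (monomial ` exponents))"
  by (rule reed_muller_information_set[OF zero_notin_monomials card_monomials two_less_m])
    (rule monomials_injective)

lemma monomial_dual_information_set:
  "information_set UNIV (reed_muller (m - 3) m) (- insert 0 (monomial ` exponents))"
  unfolding m_minus[symmetric]
  by (rule dual_reed_muller_information_set[OF zero_notin_monomials card_monomials two_less_m])
    (rule monomials_injective)

lemma monomial_check_positions:
  assumes "S \<subseteq> {0..<int n}" "(\<lambda>i. \<alpha> powi i) ` S = monomial ` exponents"
  shows "check_positions {0..<int n} (punctured_cyclic n \<alpha> (reed_muller (m - 3) m)) S"
  unfolding m_minus[symmetric]
  by (rule punctured_check_positions[OF zero_notin_monomials card_monomials two_less_m _ assms])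
    (rule monomials_injective)

lemma punctured_defining_set_2:
  "cyclic_defining_set n \<alpha> (punctured_cyclic n \<alpha> (reed_muller (m - 3) m)) = int ` low_weight m 2"
  unfolding m_minus[symmetric] by (rule punctured_defining_set[OF two_less_m])

end

section \<open>Group isomorphisms and the matching roots of unity\<close>

lemma iso_linear:
  fixes T :: "int \<Rightarrow> int \<times> int"
  assumes T: "T \<in> iso (integer_mod_group n) (integer_mod_group r1 \<times>\<times> integer_mod_group r2)"
    and n: "n > 1" "r1 > 1" "r2 > 1" and T1: "T 1 = (\<delta>1, \<delta>2)"
  shows "bij_betw T {0..<int n} (positions r1 r2)"
    and "k < n \<Longrightarrow> T (int k) = ((\<delta>1 * int k) mod int r1, (\<delta>2 * int k) mod int r2)"
    and "coprime \<delta>1 (int r1)" "coprime \<delta>2 (int r2)"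
proof -
  have car: "carrier (integer_mod_group n) = {0..<int n}"
    "carrier (integer_mod_group r1 \<times>\<times> integer_mod_group r2) = positions r1 r2"
    using n by (simp_all add: carrier_integer_mod_group positions_def)
  have "bij_betw T (carrier (integer_mod_group n)) (carrier (integer_mod_group r1 \<times>\<times> integer_mod_group r2))"
    and T_hom: "T \<in> hom (integer_mod_group n) (integer_mod_group r1 \<times>\<times> integer_mod_group r2)"
    using T unfolding iso_def by blast+
  then show bij: "bij_betw T {0..<int n} (positions r1 r2)" by (simp only: car)
  have hom: "T ((x + y) mod int n) = ((fst (T x) + fst (T y)) mod int r1, (snd (T x) + snd (T y)) mod int r2)"
    if "x \<in> {0..<int n}" "y \<in> {0..<int n}" for x y
    using hom_mult[OF T_hom, of x y] that unfolding car(1)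
    by (simp add: DirProd_def case_prod_unfold)
  have in_pos: "T x \<in> positions r1 r2" if "x \<in> {0..<int n}" for x
    using bij that by (auto simp: bij_betw_def)
  have lin: "T (int k) = ((\<delta>1 * int k) mod int r1, (\<delta>2 * int k) mod int r2)" if "k < n" for k
    using that
  proof (induction k)
    case 0
    have "T 0 = ((fst (T 0) + fst (T 0)) mod int r1, (snd (T 0) + snd (T 0)) mod int r2)"
      using hom[of 0 0] n by simp
    moreover have "T 0 \<in> positions r1 r2" using in_pos n by simp
    \<comment> \<open>Each component of \<open>T 0\<close> equals its own double modulo
      \<open>r\<close>, which leaves only 0.\<close>
    moreover have "x = 0" if "0 \<le> x" "x < int r" "x = (x + x) mod int r" for x :: int and r
    proof -
      have "(x + x) mod int r = x mod int r" using that by simp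
      then have "int r dvd x + x - x" by (simp only: mod_eq_dvd_iff)
      then show ?thesis using that by (auto dest: zdvd_imp_le)
    qed
    ultimately have "fst (T 0) = 0 \<and> snd (T 0) = 0"
      by (metis (no_types, lifting) SigmaE atLeastLessThan_iff fst_conv positions_def snd_conv)
    then show ?case by (simp add: prod_eq_iff)
  next
    case (Suc k)
    have "T (int (Suc k)) = T ((int k + 1) mod int n)" using Suc.prems by (simp add: add.commute)
    also have "\<dots> = ((fst (T (int k)) + \<delta>1) mod int r1, (snd (T (int k)) + \<delta>2) mod int r2)"
      using hom[of "int k" 1] Suc.prems n T1 by simp
    also have "\<dots> = ((\<delta>1 * int (Suc k)) mod int r1, (\<delta>2 * int (Suc k)) mod int r2)"
      using Suc by (simp add: mod_simps algebra_simps)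
    finally show ?case .
  qed
  then show "k < n \<Longrightarrow> T (int k) = ((\<delta>1 * int k) mod int r1, (\<delta>2 * int k) mod int r2)" .
  \<comment> \<open>A preimage of this pair is an inverse of both multipliers, so they are
    units.\<close>
  have "(1, 1) \<in> positions r1 r2" using n by (simp add: positions_def)
  then obtain x where "x \<in> {0..<int n}" "T x = (1, 1)" using bij by (metis bij_betw_imp_surj_on imageE)
  then have "(\<delta>1 * x) mod int r1 = 1" "(\<delta>2 * x) mod int r2 = 1" using lin[of "nat x"] by auto
  then have "[\<delta>1 * x = 1] (mod int r1)" "[\<delta>2 * x = 1] (mod int r2)" using n by (simp_all add: cong_def)
  then show "coprime \<delta>1 (int r1)" "coprime \<delta>2 (int r2)" by (metis coprime_iff_invertible_int)+
qed

text \<open>The Bezout relation makes \<open>\<eta>2\<close> a unit modulo \<open>r1\<close>, so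
  \<open>y\<close> has order \<open>r1\<close>. The exponent inverse to \<open>\<delta>\<close>
  preserves this order and cancels the multiplier that \<open>T\<close> introduces.\<close>

lemma root_component:
  fixes x :: "'a::field"
  assumes x: "primitive_root_of_unity (r1 * r2) x" and r: "r1 > 1" "r2 > 1"
    and \<eta>: "\<eta>1 * int r1 + \<eta>2 * int r2 = 1" and \<delta>: "coprime \<delta> (int r1)"
    and y: "y = x powi (\<eta>2 * int r2)" and z: "z = y powi modular_inverse (int r1) \<delta>"
  shows "primitive_root_of_unity r1 z" "z powi ((\<delta> * k) mod int r1) = y powi k"
proof -
  note iff = primitive_powi_eq_iff[OF x]
  have "x \<noteq> 0" using x by (auto simp: primitive_root_of_unity_def power_0_left)
  have cop: "coprime (\<eta>2) (int r1)" using \<eta> by (metis coprime_iff_invertible_int cong_iff_lin add.commute mult.commute cong_sym)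
  have yiff: "y powi i = y powi j \<longleftrightarrow> i mod int r1 = j mod int r1" for i j
  proof -
    have "y powi i = y powi j \<longleftrightarrow> int r1 * int r2 dvd \<eta>2 * int r2 * i - \<eta>2 * int r2 * j"
      unfolding y power_int_mult[symmetric] iff by (simp only: mod_eq_dvd_iff of_nat_mult)
    also have "\<dots> \<longleftrightarrow> int r1 * int r2 dvd \<eta>2 * (i - j) * int r2"
      by (simp add: algebra_simps)
    also have "\<dots> \<longleftrightarrow> int r1 dvd \<eta>2 * (i - j)" using r by simp
    also have "\<dots> \<longleftrightarrow> int r1 dvd i - j"
      using cop by (simp add: coprime_dvd_mult_right_iff coprime_commute)
    finally show ?thesis by (simp add: mod_eq_dvd_iff)
  qed
  have "[modular_inverse (int r1) \<delta> * \<delta> = 1] (mod int r1)" by (rule cong_modular_inverse2[OF \<delta>])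
  then have inv: "(modular_inverse (int r1) \<delta> * ((\<delta> * k) mod int r1)) mod int r1 = k mod int r1" for k
    by (metis cong_def cong_scalar_right mod_mult_right_eq mult.assoc mult_1)
  then show "z powi ((\<delta> * k) mod int r1) = y powi k"
    unfolding z power_int_mult[symmetric] yiff .
  have zy: "z powi k = y powi (modular_inverse (int r1) \<delta> * k)" for k
    unfolding z power_int_mult ..
  have copi: "coprime (modular_inverse (int r1) \<delta>) (int r1)" using \<delta> by (rule coprime_modular_inverse)
  have "z powi k = 1 \<longleftrightarrow> int r1 dvd k" for k
  proof -
    have "z powi k = 1 \<longleftrightarrow> y powi (modular_inverse (int r1) \<delta> * k) = y powi 0" by (simp add: zy)
    also have "\<dots> \<longleftrightarrow> int r1 dvd modular_inverse (int r1) \<delta> * k" unfolding yiff by auto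
    also have "\<dots> \<longleftrightarrow> int r1 dvd k"
      using copi by (simp add: coprime_dvd_mult_right_iff coprime_commute)
    finally show ?thesis .
  qed
  from this[of "int _"] have "z ^ k = 1 \<longleftrightarrow> r1 dvd k" for k by simp
  then show "primitive_root_of_unity r1 z" using r by (auto simp: primitive_root_of_unity_def dest: dvd_imp_le)
qed

section \<open>The check positions\<close>

text \<open>\<open>T_root\<close> expresses that the roots fit \<open>T\<close>: the field element
  at the cyclic position \<open>k\<close> is the monomial with exponent pair
  \<open>T k\<close>.\<close>

locale split_positions = two_roots m n \<alpha> a b r1 r2 \<beta>1 \<beta>2
  for m n and \<alpha> :: "'a::{field,finite}" and a b r1 r2 \<beta>1 \<beta>2 +
  fixes T :: "int \<Rightarrow> int \<times> int" and \<delta>1 \<delta>2 :: int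
  assumes T_bij: "bij_betw T {0..<int n} (positions r1 r2)"
    and T_lin: "k < n \<Longrightarrow> T (int k) = ((\<delta>1 * int k) mod int r1, (\<delta>2 * int k) mod int r2)"
    and \<delta>_cop: "coprime \<delta>1 (int r1)" "coprime \<delta>2 (int r2)"
    and T_root: "k < n \<Longrightarrow> \<alpha> ^ k = monomial (nat (fst (T (int k))), nat (snd (T (int k))))"
begin

definition D :: "(int \<times> int) set" where
  "D = T ` int ` low_weight m 2"

text \<open>The effect of \<open>T\<close> on residues modulo \<open>r1\<close>. As multiplication
  by a unit it preserves fibre sizes, so the sequences are the same for every
  \<open>T\<close>.\<close>

definition scale1 :: "nat \<Rightarrow> int" where
  "scale1 u = (\<delta>1 * int u) mod int r1"

definition scale2 :: "nat \<Rightarrow> int" where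
  "scale2 u = (\<delta>2 * int u) mod int r2"

lemma scale1_eq_iff: "scale1 u = scale1 v \<longleftrightarrow> u mod r1 = v mod r1"
proof -
  have "scale1 u = scale1 v \<longleftrightarrow> [\<delta>1 * int u = \<delta>1 * int v] (mod int r1)"
    by (simp add: scale1_def cong_def)
  also have "\<dots> \<longleftrightarrow> [int u = int v] (mod int r1)" by (rule cong_mult_lcancel[OF \<delta>_cop(1)])
  also have "\<dots> \<longleftrightarrow> [u = v] (mod r1)" by (rule cong_int_iff)
  finally show ?thesis by (simp add: cong_def)
qed

lemma scale2_eq_iff: "scale2 u = scale2 v \<longleftrightarrow> u mod r2 = v mod r2"
proof -
  have "scale2 u = scale2 v \<longleftrightarrow> [\<delta>2 * int u = \<delta>2 * int v] (mod int r2)"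
    by (simp add: scale2_def cong_def)
  also have "\<dots> \<longleftrightarrow> [int u = int v] (mod int r2)" by (rule cong_mult_lcancel[OF \<delta>_cop(2)])
  also have "\<dots> \<longleftrightarrow> [u = v] (mod r2)" by (rule cong_int_iff)
  finally show ?thesis by (simp add: cong_def)
qed

lemma T_low: "s \<in> low_weight m 2 \<Longrightarrow> T (int s) = (scale1 s, scale2 s)"
  by (simp add: T_lin scale1_def scale2_def low_weight_n)

lemma mem_D: "p \<in> D \<longleftrightarrow> (\<exists>s\<in>low_weight m 2. p = (scale1 s, scale2 s))"
  unfolding D_def using T_low by (auto simp: image_iff)

lemma odd_r: "odd r1" "odd r2"
proof -
  have "odd n" using m4 by (simp add: n_eq)
  then show "odd r1" "odd r2" by (simp_all add: n_prod)
qed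

lemma D_double:
  assumes "(x, y) \<in> D"
  shows "((2 * x) mod int r1, (2 * y) mod int r2) \<in> D"
proof -
  obtain s where s: "s \<in> low_weight m 2" "x = scale1 s" "y = scale2 s" using assms mem_D by auto
  have mod: "scale1 ((2 * s) mod n) = scale1 (2 * s)" "scale2 ((2 * s) mod n) = scale2 (2 * s)"
    unfolding scale1_eq_iff scale2_eq_iff n_prod by (simp_all add: mod_mod_cancel)
  have "(2 * x) mod int r1 = scale1 (2 * s)" "(2 * y) mod int r2 = scale2 (2 * s)"
    unfolding s scale1_def scale2_def by (simp_all add: mod_mult_right_eq mult.left_commute)
  then show ?thesis
    using double_mod_in_low_weight[OF s(1)] mod unfolding mem_D n_eq[symmetric] by metis
qed

lemma D_positions: "D \<subseteq> positions r1 r2"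
  using r_pos by (auto simp: mem_D positions_def scale1_def scale2_def)

lemma fst_D: "fst ` D = scale1 ` strict_residues a \<union> scale1 ` equal_residues a"
proof -
  have "fst ` D = scale1 ` low_weight m 2" by (force simp: mem_D image_iff)
  also have "\<dots> = scale1 ` (\<lambda>s. s mod r1) ` low_weight m 2"
    unfolding image_image by (rule image_cong) (simp_all add: scale1_eq_iff)
  also have "(\<lambda>s. s mod r1) ` low_weight m 2 = strict_residues a \<union> equal_residues a"
    using low_weight_2_residues[OF a2 m3] by (simp add: m_eq r1_eq)
  finally show ?thesis by (simp only: image_Un)
qed

lemma card_slice:
  assumes "u \<in> strict_residues a \<union> equal_residues a"
  shows "card {y. (scale1 u, y) \<in> D} = card (fibre m r1 u)"
proof -
  have "u mod r1 = u" using residues_less[OF assms] by simp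
  then have "{y. (scale1 u, y) \<in> D} = scale2 ` fibre m r1 u"
    by (auto simp: mem_D fibre_def scale1_eq_iff)
  moreover have "inj_on scale2 (fibre m r1 u)"
    by (rule inj_onI) (auto simp: fibre_def low_weight_n scale2_eq_iff intro: crt_unique)
  ultimately show ?thesis by (simp add: card_image)
qed

lemma sequences:
  assumes "restricted_representatives r1 r2 D Dbar"
  shows "s_len r1 r2 Dbar = 2"
    and "f_seq r1 r2 Dbar 1 = b ^ 2" "f_seq r1 r2 Dbar 2 = b * (b + 1) div 2" "f_seq r1 r2 Dbar 3 = 0"
    and "g_seq r1 r2 Dbar 1 = a * (a - 1) div 2" "g_seq r1 r2 Dbar 2 = a * (a + 1) div 2"
proof -
  interpret R: restricted_representation r1 r2 D Dbar
    by unfold_locales (use odd_r D_positions D_double assms in auto)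
  have inj: "inj_on scale1 (strict_residues a \<union> equal_residues a)"
    by (rule inj_onI) (use residues_less in \<open>simp add: scale1_eq_iff\<close>)
  have disj: "scale1 ` strict_residues a \<inter> scale1 ` equal_residues a = {}"
    using inj_on_image_Int[OF inj, of "strict_residues a" "equal_residues a"] residues(1) by simp
  have ne: "scale1 ` strict_residues a \<noteq> {}" "scale1 ` equal_residues a \<noteq> {}"
    using strict_nonempty equal_nonempty by simp_all
  have A: "card (R.slice u) = b ^ 2" if "u \<in> scale1 ` strict_residues a" for u
    using that card_slice fibre_strict by (auto simp: R.slice_def)
  have B: "card (R.slice u) = b * (b + 1) div 2" if "u \<in> scale1 ` equal_residues a" for u
    using that card_slice fibre_equal by (auto simp: R.slice_def)
  have cs: "card (scale1 ` strict_residues a) = a * (a - 1) div 2" "card (scale1 ` equal_residues a) = a"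
    using residues(2,3) by (simp_all add: card_image inj_on_subset[OF inj])
  note two = R.two_valued_sequences[OF fst_D disj ne A B triangle_less_square, unfolded cs triangle_split]
  show "s_len r1 r2 Dbar = 2"
    "f_seq r1 r2 Dbar 1 = b ^ 2" "f_seq r1 r2 Dbar 2 = b * (b + 1) div 2" "f_seq r1 r2 Dbar 3 = 0"
    "g_seq r1 r2 Dbar 1 = a * (a - 1) div 2" "g_seq r1 r2 Dbar 2 = a * (a + 1) div 2"
    by (rule two; assumption)+
qed

definition check_set :: "(int \<times> int) set" where
  "check_set = {(i1, i2) \<in> {0..<int r1} \<times> {0..<int r2}.
     (0 \<le> i1 \<and> i1 < int (a * (a - 1) div 2) \<and> 0 \<le> i2 \<and> i2 < int (b ^ 2)) \<or>
     (int (a * (a - 1) div 2) \<le> i1 \<and> i1 < int (a * (a + 1) div 2) \<and>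
      0 \<le> i2 \<and> i2 < int (b * (b + 1) div 2))}"

text \<open>\<open>Gamma_set\<close> cuts the staircase along the second coordinate,
  \<open>check_set\<close> along the first. For decreasing heights and increasing widths both
  describe the same region.\<close>

lemma Gamma_eq:
  assumes "restricted_representatives r1 r2 D Dbar"
  shows "Gamma_set r1 r2 Dbar = check_set"
proof -
  note seq = sequences[OF assms]
  have "(\<exists>j. 1 \<le> j \<and> j \<le> (2::nat) \<and> Q j) \<longleftrightarrow> Q 1 \<or> Q 2" for Q
  proof
    assume "\<exists>j. 1 \<le> j \<and> j \<le> (2::nat) \<and> Q j"
    then obtain j where j: "1 \<le> j" "j \<le> (2::nat)" "Q j" by (elim exE conjE)
    then have "j = 1 \<or> j = 2" by linarith
    then show "Q 1 \<or> Q 2" using j(3) by (elim disjE) simp_all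
  next
    assume "Q 1 \<or> Q 2"
    then show "\<exists>j. 1 \<le> j \<and> j \<le> (2::nat) \<and> Q j"
      by (elim disjE) (rule exI[of _ 1], simp, rule exI[of _ 2], simp)
  qed
  moreover have "(1::nat) + 1 = 2" "(2::nat) + 1 = 3" by simp_all
  ultimately have "Gamma_set r1 r2 Dbar = {(i1, i2) \<in> positions r1 r2.
      (int (b * (b + 1) div 2) \<le> i2 \<and> i2 < int (b ^ 2) \<and> 0 \<le> i1 \<and> i1 < int (a * (a - 1) div 2)) \<or>
      (int 0 \<le> i2 \<and> i2 < int (b * (b + 1) div 2) \<and> 0 \<le> i1 \<and> i1 < int (a * (a + 1) div 2))}"
    unfolding Gamma_set_def seq(1) by (simp only: seq)
  also have "\<dots> = check_set"
  proof -
    have "{(i1, i2) \<in> X \<times> Y. (F2 \<le> i2 \<and> i2 < F1 \<and> 0 \<le> i1 \<and> i1 < G1) \<or>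
        (int 0 \<le> i2 \<and> i2 < F2 \<and> 0 \<le> i1 \<and> i1 < G2)}
      = {(i1, i2) \<in> X \<times> Y. (0 \<le> i1 \<and> i1 < G1 \<and> 0 \<le> i2 \<and> i2 < F1) \<or>
        (G1 \<le> i1 \<and> i1 < G2 \<and> 0 \<le> i2 \<and> i2 < F2)}"
      if "0 < F2" "F2 < F1" "0 \<le> G1" "G1 \<le> G2" for X Y and F1 F2 G1 G2 :: int
      using that by auto
    then show ?thesis
      unfolding check_set_def positions_def
      using triangle_less_square triangle_split by (simp only: of_nat_less_iff of_nat_0_less_iff)
  qed
  finally show ?thesis .
qed

lemma check_set_iff:
  "(i1, i2) \<in> positions r1 r2 \<Longrightarrow> (i1, i2) \<in> check_set \<longleftrightarrow> (nat i1, nat i2) \<in> exponents"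
  by (auto simp: check_set_def positions_def exponents_def nat_less_iff le_nat_iff)

lemma powi_mem_monomials_iff:
  assumes i: "i \<in> {0..<int n}"
  shows "\<alpha> powi i \<in> monomial ` exponents \<longleftrightarrow> T i \<in> check_set"
proof -
  have pos: "T i \<in> positions r1 r2" using T_bij i by (auto simp: bij_betw_def)
  have nn: "0 \<le> i" "nat i < n" using i by auto
  then have "\<alpha> powi i = monomial (nat (fst (T i)), nat (snd (T i)))"
    using T_root[of "nat i"] by (simp add: power_int_def)
  moreover have "(nat (fst (T i)), nat (snd (T i))) \<in> {..<r1} \<times> {..<r2}"
    using pos by (auto simp: positions_def)
  ultimately have "\<alpha> powi i \<in> monomial ` exponents \<longleftrightarrow> (nat (fst (T i)), nat (snd (T i))) \<in> exponents"
    using inj_on_image_mem_iff[OF monomial_inj _ exponents_subset] by simp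
  then show ?thesis using check_set_iff[of "fst (T i)" "snd (T i)"] pos by simp
qed

lemma nonzero_powi: "g \<noteq> 0 \<Longrightarrow> \<exists>i\<in>{0..<int n}. g = \<alpha> powi i"
proof -
  assume "g \<noteq> 0"
  then have "g \<in> (\<lambda>i. \<alpha> ^ i) ` {..<n}" unfolding alpha_image by simp
  then obtain k where "k < n" "g = \<alpha> ^ k" by blast
  then show ?thesis by (intro bexI[of _ "int k"]) auto
qed

lemma powi_image_check_set: "{\<alpha> powi i | i. i \<in> {0..<int n} \<and> T i \<in> check_set} = monomial ` exponents"
proof
  show "{\<alpha> powi i | i. i \<in> {0..<int n} \<and> T i \<in> check_set} \<subseteq> monomial ` exponents"
    using powi_mem_monomials_iff by blast
  show "monomial ` exponents \<subseteq> {\<alpha> powi i | i. i \<in> {0..<int n} \<and> T i \<in> check_set}"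
  proof
    fix g assume g: "g \<in> monomial ` exponents"
    then have "g \<noteq> 0" using zero_notin_monomials by metis
    then obtain i where "i \<in> {0..<int n}" "g = \<alpha> powi i" using nonzero_powi by blast
    then show "g \<in> {\<alpha> powi i | i. i \<in> {0..<int n} \<and> T i \<in> check_set}" using g powi_mem_monomials_iff by blast
  qed
qed

lemma powi_image_complement:
  "{\<alpha> powi i | i. i \<in> {0..<int n} \<and> T i \<notin> check_set} = - insert 0 (monomial ` exponents)"
proof
  show "{\<alpha> powi i | i. i \<in> {0..<int n} \<and> T i \<notin> check_set} \<subseteq> - insert 0 (monomial ` exponents)"
  proof
    fix g assume "g \<in> {\<alpha> powi i | i. i \<in> {0..<int n} \<and> T i \<notin> check_set}"
    then obtain i where i: "i \<in> {0..<int n}" "g = \<alpha> powi i" "T i \<notin> check_set" by blast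
    then have "g \<notin> monomial ` exponents" "g \<noteq> 0" using powi_mem_monomials_iff by auto
    then show "g \<in> - insert 0 (monomial ` exponents)" by simp
  qed
  show "- insert 0 (monomial ` exponents) \<subseteq> {\<alpha> powi i | i. i \<in> {0..<int n} \<and> T i \<notin> check_set}"
  proof
    fix g assume g: "g \<in> - insert 0 (monomial ` exponents)"
    then obtain i where "i \<in> {0..<int n}" "g = \<alpha> powi i" using nonzero_powi[of g] by auto
    then show "g \<in> {\<alpha> powi i | i. i \<in> {0..<int n} \<and> T i \<notin> check_set}" using g powi_mem_monomials_iff by blast
  qed
qed

end

theorem theorem46:
  fixes m a b n r1 r2 :: nat
    and \<alpha> \<alpha>1 \<alpha>2 \<beta>1 \<beta>2 :: "'a::{field,finite}"
    and \<eta>1 \<eta>2 \<delta>1 \<delta>2 :: int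
    and T :: "int \<Rightarrow> int \<times> int"
    and Cstar :: "(int \<Rightarrow> bit) set" and Dstar :: "int set"
    and C :: "(int \<times> int \<Rightarrow> bit) set"
    and Dbar \<Gamma> :: "(int \<times> int) set"
  assumes "CARD('a) = 2 ^ m"
    and "n = 2 ^ m - 1" and "n = r1 * r2" and "m = a * b" and "r1 = 2 ^ a - 1"
    and "coprime r1 r2" and "r1 > 1" and "r2 > 1"
    and "primitive_root_of_unity n \<alpha>"
    and "T \<in> iso (integer_mod_group n) (integer_mod_group r1 \<times>\<times> integer_mod_group r2)"
    and "Cstar = punctured_cyclic n \<alpha> (reed_muller (m - 3) m)"
    and "Dstar = cyclic_defining_set n \<alpha> Cstar"
    and "\<eta>1 * int r1 + \<eta>2 * int r2 = 1"
    and "\<alpha>1 = \<alpha> powi (\<eta>2 * int r2)" and "\<alpha>2 = \<alpha> powi (\<eta>1 * int r1)"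
    and "T 1 = (\<delta>1, \<delta>2)"
    and "\<beta>1 = \<alpha>1 powi modular_inverse (int r1) \<delta>1"
    and "\<beta>2 = \<alpha>2 powi modular_inverse (int r2) \<delta>2"
    and "ideal C (abelian_algebra r1 r2)"
    and "abelian_defining_set r1 r2 \<beta>1 \<beta>2 C = T ` Dstar"
    and "restricted_representatives r1 r2 (abelian_defining_set r1 r2 \<beta>1 \<beta>2 C) Dbar"
    and "\<Gamma> = Gamma_set r1 r2 Dbar"
  shows "s_len r1 r2 Dbar = 2
    \<and> f_seq r1 r2 Dbar 1 = b ^ 2 \<and> f_seq r1 r2 Dbar 2 = b * (b + 1) div 2
    \<and> g_seq r1 r2 Dbar 1 = a * (a - 1) div 2 \<and> g_seq r1 r2 Dbar 2 = a * (a + 1) div 2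
    \<and> \<Gamma> = {(i1, i2) \<in> {0..<int r1} \<times> {0..<int r2}.
            (0 \<le> i1 \<and> i1 < int (a * (a - 1) div 2) \<and> 0 \<le> i2 \<and> i2 < int (b ^ 2)) \<or>
            (int (a * (a - 1) div 2) \<le> i1 \<and> i1 < int (a * (a + 1) div 2) \<and>
             0 \<le> i2 \<and> i2 < int (b * (b + 1) div 2))}
    \<and> check_positions {0..<int n} Cstar {i \<in> {0..<int n}. T i \<in> \<Gamma>}
    \<and> information_set UNIV (reed_muller 2 m :: ('a \<Rightarrow> bit) set)
        ({0} \<union> {\<alpha> powi i | i. i \<in> {0..<int n} \<and> T i \<in> \<Gamma>})
    \<and> information_set UNIV (reed_muller (m - 3) m :: ('a \<Rightarrow> bit) set)
        {\<alpha> powi i | i. i \<in> {0..<int n} \<and> T i \<notin> \<Gamma>}"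
proof -
  have n1: "n > 1" using assms(3,7,8) by (metis less_1_mult)
  have a2: "2 \<le> a"
  proof (rule ccontr)
    assume "\<not> 2 \<le> a"
    then have "a = 0 \<or> a = 1" by auto
    then show False using assms(5,7) by auto
  qed
  have b2: "2 \<le> b"
  proof (rule ccontr)
    assume "\<not> 2 \<le> b"
    then consider "b = 0" | "b = 1" by linarith
    then show False
    proof cases
      case 1
      then show False using n1 assms(2,4) by simp
    next
      case 2
      then have "n = r1" using assms(2,4,5) by simp
      then show False using assms(3,7,8) by simp
    qed
  qed
  note iso = iso_linear[OF assms(10) n1 assms(7,8,16)]
  have \<eta>': "\<eta>2 * int r2 + \<eta>1 * int r1 = 1" using assms(13) by simp
  have prim: "primitive_root_of_unity (r1 * r2) \<alpha>" "primitive_root_of_unity (r2 * r1) \<alpha>"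
    using assms(3,9) by (simp_all add: mult.commute)
  note comp1 = root_component[OF prim(1) assms(7,8) assms(13) iso(3) assms(14,17)]
  \<comment> \<open>The second component is the first with the indices exchanged, also in the Bezout
    relation.\<close>
  note comp2 = root_component[OF prim(2) assms(8,7) \<eta>' iso(4) assms(15,18)]
  interpret two_roots m n \<alpha> a b r1 r2 \<beta>1 \<beta>2
    by unfold_locales (fact assms a2 b2 comp1(1) comp2(1))+
  interpret split_positions m n \<alpha> a b r1 r2 \<beta>1 \<beta>2 T \<delta>1 \<delta>2
  proof unfold_locales
    fix k assume k: "k < n"
    have "(\<delta>1 * int k) mod int r1 \<ge> 0" "(\<delta>2 * int k) mod int r2 \<ge> 0" using r_pos by simp_all
    then have "monomial (nat (fst (T (int k))), nat (snd (T (int k))))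
        = \<beta>1 powi ((\<delta>1 * int k) mod int r1) * \<beta>2 powi ((\<delta>2 * int k) mod int r2)"
      by (simp add: monomial_def iso(2)[OF k] power_int_def)
    also have "\<dots> = \<alpha>1 powi int k * \<alpha>2 powi int k" unfolding comp1(2) comp2(2) ..
    \<comment> \<open>The two exponents of \<open>\<alpha>\<close> add up to 1 by the Bezout
      relation, so the two components recombine to \<open>\<alpha> ^ k\<close>.\<close>
    also have "\<dots> = (\<alpha> powi (\<eta>2 * int r2 + \<eta>1 * int r1)) powi int k"
      unfolding assms(14,15) by (simp only: power_int_mult_distrib power_int_add[OF disjI1[OF alpha_nz]])
    also have "\<dots> = \<alpha> ^ k" unfolding \<eta>' by simp
    finally show "\<alpha> ^ k = monomial (nat (fst (T (int k))), nat (snd (T (int k))))" by (rule sym)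
  qed (fact iso)+
  have "abelian_defining_set r1 r2 \<beta>1 \<beta>2 C = D"
    unfolding assms(20) D_def assms(11,12) punctured_defining_set_2 ..
  then have rep: "restricted_representatives r1 r2 D Dbar" using assms(21) by simp
  have \<Gamma>: "\<Gamma> = check_set" unfolding assms(22) by (rule Gamma_eq[OF rep])
  have "check_positions {0..<int n} Cstar {i \<in> {0..<int n}. T i \<in> check_set}"
    unfolding assms(11)
  proof (rule monomial_check_positions)
    show "(\<lambda>i. \<alpha> powi i) ` {i \<in> {0..<int n}. T i \<in> check_set} = monomial ` exponents"
      unfolding powi_image_check_set[symmetric] by blast
  qed blast
  moreover have "information_set UNIV (reed_muller 2 m :: ('a \<Rightarrow> bit) set)
      ({0} \<union> {\<alpha> powi i | i. i \<in> {0..<int n} \<and> T i \<in> check_set})"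
    unfolding powi_image_check_set using monomial_information_set by simp
  moreover have "information_set UNIV (reed_muller (m - 3) m :: ('a \<Rightarrow> bit) set)
      {\<alpha> powi i | i. i \<in> {0..<int n} \<and> T i \<notin> check_set}"
    unfolding powi_image_complement by (rule monomial_dual_information_set)
  ultimately show ?thesis
    unfolding \<Gamma> using sequences[OF rep] by (simp only: check_set_def simp_thms)
qed

end
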